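(* Let $A\in\mathbb{C}^{n\times n}$ be a nonzero matrix. Then the following conditions are equivalent: 1. $\|A\|=2r(A)$; 2. $\Theta_A$ is non-empty; 3. $\Theta_A=\Omega_A$; 4. for every $v\in\mathcal{V}_{max}(A)$ with $\|v\|=1$ it holds that $v\in\mathcal{R}(A^* )\cap\mathcal{N}(A^* )$, $Av\in\mathcal{R}(A)\cap\mathcal{N}(A)$, and the vector $z=\frac{1}{\sqrt2}\left(v+\frac{Av}{\|A\|}\right)$ maximizes $|\langle Az,z\rangle|$ (over unit norm vectors); 5. there exists $v\in\mathcal{V}_{max}(A)$ with $\|v\|=1$ such that $v\in\mathcal{R}(A^* )\cap\mathcal{N}(A^* )$, $Av\in\mathcal{R}(A)\cap\mathcal{N}(A)$, and the vector $z=\frac{1}{\sqrt2}\left(v+\frac{Av}{\|A\|}\right)$ maximizes $|\langle Az,z\rangle|$ (over unit norm vectors); 6. $A$ is unitarily similar to a matrix of the form $(\|A\| I_m\otimes J)\oplus B$, where $m$ is the dimension of $\mathcal{V}_{max}(A)$, and $B$ is a square matrix satisfying $\|B\|<\|A\|$ and $r(B)\le\frac12\|A\|$; 7. $W(A)$ is the (closed) disk with the center at zero and the radius $\frac12\|A\|$.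
   Context: $\mathbb{C}^n$ carries the Euclidean inner product $\langle z,w\rangle=w^*z$ and norm $\|z\|=(z^*z)^{1/2}$; $*$ is the Hermitian transpose; $\|A\|$ is the matrix 2-norm (operator norm). The field of values is $W(A)=\{\langle Az,z\rangle: z\in\mathbb{C}^n,\ \|z\|=1\}$ and the numerical radius is $r(A)=\max_{\|z\|=1}|\langle Az,z\rangle|$. $\mathcal{R}(\cdot)$ and $\mathcal{N}(\cdot)$ denote the range and null space. $\mathcal{V}_{max}(A)=\{x\in\mathbb{C}^n: \|Ax\|=\|A\|\|x\|\}$ is the maximum right singular subspace, i.e. the span of the right singular vectors of $A$ corresponding to the largest singular value $\sigma_{max}=\|A\|$. Every $z\in\mathbb{C}^n$ decomposes uniquely as $z=x+y$ with $x\in\mathcal{R}(A^* )$, $y\in\mathcal{N}(A)$. With this decomposition, $$\Theta_A=\{z\in\mathbb{C}^n:\ \|z\|=1,\ r(A)=|\langle Az,z\rangle|,\ \langle Ax,x\rangle=0\}.$$ Further, $$\Omega_A=\left\{\tfrac{1}{\sqrt2}\left(e^{\mathbf{i}\alpha}v+e^{\mathbf{i}\beta}u\right):\ v\in\mathcal{V}_{max}(A),\ \|v\|=1,\ u=\tfrac{Av}{\|A\|},\ \alpha,\beta\in\mathbb{R}\right\}.$$ $J=\begin{bmatrix}0&1\\0&0\end{bmatrix}$, $I_m$ is the $m\times m$ identity, $\otimes$ is the Kronecker product (so $\|A\|I_m\otimes J$ is block diagonal with $m$ copies of $\|A\|J$), and $\oplus$ denotes the block-diagonal matrix with the given blocks.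 $B$ has size $n-2m$; if $n=2m$ the block $B$ is absent and the conditions on it are vacuous. Two matrices $M,N$ are unitarily similar if $N=Q^*MQ$ for some unitary $Q$. *)

theory Defs
  imports
    "HOL-Analysis.Elementary_Metric_Spaces"
    "Jordan_Normal_Form.Schur_Decomposition"
    "Jordan_Normal_Form.Matrix_Kernel"
begin

text \<open>The inner product \<open>\<langle>z, w\<rangle> = w\<^sup>* z\<close> is \<open>z \<bullet>c w\<close>, which conjugates its second argument.\<close>

definition euclid_norm :: "complex vec \<Rightarrow> real" where
  "euclid_norm z = sqrt (Re (z \<bullet>c z))"

text \<open>Suprema over the unit ball and the unit sphere of a finite-dimensional space are attained.
  For a matrix of size 0 the unit sphere is empty, so \<open>num_radius\<close> is not meaningful there.\<close>

definition op_norm :: "complex mat \<Rightarrow> real" where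
  "op_norm A = Sup {euclid_norm (A *\<^sub>v x) | x. x \<in> carrier_vec (dim_col A) \<and> euclid_norm x \<le> 1}"

definition field_of_values :: "complex mat \<Rightarrow> complex set" where
  "field_of_values A = {(A *\<^sub>v z) \<bullet>c z | z. z \<in> carrier_vec (dim_col A) \<and> euclid_norm z = 1}"

definition num_radius :: "complex mat \<Rightarrow> real" where
  "num_radius A =
     Sup {cmod ((A *\<^sub>v z) \<bullet>c z) | z. z \<in> carrier_vec (dim_col A) \<and> euclid_norm z = 1}"

definition maximizes_num_radius :: "complex mat \<Rightarrow> complex vec \<Rightarrow> bool" where
  "maximizes_num_radius A z \<longleftrightarrow>
     z \<in> carrier_vec (dim_col A) \<and> euclid_norm z = 1 \<and>
     (\<forall>w \<in> carrier_vec (dim_col A). euclid_norm w = 1 \<longrightarrow>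
        cmod ((A *\<^sub>v w) \<bullet>c w) \<le> cmod ((A *\<^sub>v z) \<bullet>c z))"

definition mat_range :: "complex mat \<Rightarrow> complex vec set" where
  "mat_range A = (\<lambda>x. A *\<^sub>v x) ` carrier_vec (dim_col A)"

definition V_max :: "complex mat \<Rightarrow> complex vec set" where
  "V_max A = {x \<in> carrier_vec (dim_col A). euclid_norm (A *\<^sub>v x) = op_norm A * euclid_norm x}"

definition V_max_dim :: "complex mat \<Rightarrow> nat" where
  "V_max_dim A =
     vectorspace.dim class_ring ((module_vec TYPE(complex) (dim_col A))\<lparr>carrier := V_max A\<rparr>)"

definition normalized_image :: "complex mat \<Rightarrow> complex vec \<Rightarrow> complex vec" where
  "normalized_image A v = complex_of_real (1 / op_norm A) \<cdot>\<^sub>v (A *\<^sub>v v)"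

text \<open>The decomposition \<open>z = x + y\<close> below is unique, as the range of the adjoint of \<open>A\<close> is the
  orthogonal complement of the kernel of \<open>A\<close>.\<close>

definition Theta :: "complex mat \<Rightarrow> complex vec set" where
  "Theta A = {z \<in> carrier_vec (dim_col A).
     euclid_norm z = 1 \<and> num_radius A = cmod ((A *\<^sub>v z) \<bullet>c z) \<and>
     (\<exists>x \<in> mat_range (mat_adjoint A). \<exists>y \<in> mat_kernel A.
        z = x + y \<and> (A *\<^sub>v x) \<bullet>c x = 0)}"

definition Omega :: "complex mat \<Rightarrow> complex vec set" where
  "Omega A = {complex_of_real (1 / sqrt 2) \<cdot>\<^sub>v
       (exp (\<i> * complex_of_real \<alpha>) \<cdot>\<^sub>v v + exp (\<i> * complex_of_real \<beta>) \<cdot>\<^sub>v normalized_image A v)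
     | v \<alpha> \<beta>. v \<in> V_max A \<and> euclid_norm v = 1}"

definition J_mat :: "complex mat" where
  "J_mat = mat_of_rows_list 2 [[0, 1], [0, 0]]"

definition kronecker_prod :: "complex mat \<Rightarrow> complex mat \<Rightarrow> complex mat" where
  "kronecker_prod A B = mat (dim_row A * dim_row B) (dim_col A * dim_col B)
     (\<lambda>(i, j). A $$ (i div dim_row B, j div dim_col B) * B $$ (i mod dim_row B, j mod dim_col B))"

definition unitarily_similar :: "nat \<Rightarrow> complex mat \<Rightarrow> complex mat \<Rightarrow> bool" where
  "unitarily_similar n M N \<longleftrightarrow>
     M \<in> carrier_mat n n \<and> N \<in> carrier_mat n n \<and>
     (\<exists>Q \<in> carrier_mat n n.
        mat_adjoint Q * Q = 1\<^sub>m n \<and> Q * mat_adjoint Q = 1\<^sub>m n \<and> N = mat_adjoint Q * M * Q)"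

end

theory Submission
  imports
    "HOL-Analysis.Function_Topology"
    "HOL-Analysis.Topology_Euclidean_Space"
    Defs
begin

text \<open>
  Write \<open>s = \<parallel>A\<parallel>\<close> and \<open>r = r(A)\<close>. The inequality \<open>s \<le> 2 r\<close> always holds, and the theorem describes the
  case of equality.

  Take a unit vector \<open>v\<close> with \<open>\<parallel>A v\<parallel> = s\<close>, put \<open>u = A v / s\<close>, and test the form \<open>\<langle>A z, z\<rangle>\<close> on
  \<open>z = v + \<phi> u\<close> with \<open>\<phi>\<close> of modulus one. This yields (\<open>phase_inequality\<close>)
  \<open>Re (\<phi>\<^sup>2 \<langle>A u, v\<rangle> + \<phi> \<langle>A u, u\<rangle>) \<le> (2 r - s) (1 + Re (\<phi> \<langle>u, v\<rangle>))\<close>.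
  Averaging over the four fourth roots of unity kills the left-hand side and proves \<open>s \<le> 2 r\<close>. If
  \<open>s = 2 r\<close>, the right-hand side is zero, the left-hand side must then vanish at these four phases,
  and \<open>v + u\<close> and \<open>v - u\<close> turn out to be zeros of positive semidefinite Hermitian forms. They
  therefore lie in the kernels of these forms, which amounts to \<open>A u = 0\<close> and \<open>A\<^sup>* v = 0\<close>
  (\<open>extremal_imp_annihilated\<close>).

  This is the heart of the matter: in the extremal case \<open>v\<close> and \<open>u\<close> are orthonormal and span a
  reducing subspace on which \<open>A\<close> acts as \<open>s J\<close>. The memberships and the maximizers of \<open>|\<langle>A z, z\<rangle>|\<close> can
  be read off, and the disk is already covered by the numerical range of this two-dimensional part.
  Conversely, each of the conditions bounds \<open>r\<close> by \<open>s / 2\<close>; for \<open>\<Theta>\<close> this comes from expanding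
  \<open>\<parallel>A x - s e y\<parallel>\<^sup>2\<close> with a suitable phase \<open>e\<close>, where the case of equality also identifies \<open>\<Theta>\<close> as part of
  \<open>\<Omega>\<close> (\<open>Theta_imp_extremal\<close>).

  For the block form, the two-dimensional parts that belong to an orthonormal basis of the maximal
  singular subspace are mutually orthogonal. Splitting all of them off leaves a block that meets no
  maximal singular vector (\<open>extremal_imp_block_form\<close>).
\<close>

section \<open>Inner product, adjoint and norm\<close>

lemma smult_r_zero_vec [simp]: "c \<cdot>\<^sub>v 0\<^sub>v n = (0\<^sub>v n :: complex vec)"
  by (intro eq_vecI) auto

lemma add_zero_smult_vec:
  "w \<in> carrier_vec n \<Longrightarrow> x \<in> carrier_vec n \<Longrightarrow> w + 0 \<cdot>\<^sub>v x = (w :: complex vec)"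
  by (intro eq_vecI) auto

lemma cinner_add_left:
  assumes "v \<in> carrier_vec n" "w \<in> carrier_vec n" "z \<in> carrier_vec n"
  shows "(v + w) \<bullet>c z = v \<bullet>c z + w \<bullet>c (z :: complex vec)"
  using assms by (simp add: add_scalar_prod_distrib[of _ n])

lemma cinner_add_right:
  assumes "v \<in> carrier_vec n" "w \<in> carrier_vec n" "z \<in> carrier_vec n"
  shows "z \<bullet>c (v + w) = z \<bullet>c v + z \<bullet>c (w :: complex vec)"
  using assms by (simp add: scalar_prod_add_distrib[of _ n] conjugate_add_vec[of _ n])

lemma cinner_smult_left:
  assumes "v \<in> carrier_vec n" "z \<in> carrier_vec n"
  shows "(c \<cdot>\<^sub>v v) \<bullet>c z = c * (v \<bullet>c (z :: complex vec))"
  using assms by (simp add: smult_scalar_prod_distrib[of _ n])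

lemma cinner_smult_right:
  assumes "v \<in> carrier_vec n" "z \<in> carrier_vec n"
  shows "z \<bullet>c (c \<cdot>\<^sub>v v) = cnj c * (z \<bullet>c (v :: complex vec))"
  using assms by (simp add: scalar_prod_smult_distrib[of _ n] conjugate_smult_vec)

lemma cinner_commute:
  assumes "v \<in> carrier_vec n" "w \<in> carrier_vec n"
  shows "w \<bullet>c v = cnj (v \<bullet>c (w :: complex vec))"
  using assms by (auto simp: scalar_prod_def intro!: sum.cong)

lemmas cinner_simps = cinner_add_left cinner_add_right cinner_smult_left cinner_smult_right

lemma mat_adjoint_dims [simp]:
  "dim_row (mat_adjoint A) = dim_col A" "dim_col (mat_adjoint A) = dim_row A"
  by (auto simp: mat_adjoint_def)

lemma mat_adjoint_carrier [simp]:
  "A \<in> carrier_mat m n \<Longrightarrow> mat_adjoint A \<in> carrier_mat n m"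
  by (intro carrier_matI) auto

lemma mat_adjoint_mult_vec_carrier [simp]:
  "A \<in> carrier_mat m n \<Longrightarrow> mat_adjoint A *\<^sub>v w \<in> carrier_vec n"
  by (intro carrier_vecI) auto

lemma mat_adjoint_index:
  assumes "i < dim_col A" "j < dim_row A"
  shows "mat_adjoint A $$ (i, j) = cnj (A $$ (j, i) :: complex)"
  using assms by (auto simp: mat_adjoint_def mat_of_rows_index)

lemma mat_adjoint_adjoint [simp]: "mat_adjoint (mat_adjoint A) = (A :: complex mat)"
  by (rule eq_matI) (auto simp: mat_adjoint_index)

lemma cinner_adjoint:
  assumes A: "A \<in> carrier_mat m n" and x: "x \<in> carrier_vec n" and y: "y \<in> carrier_vec m"
  shows "(A *\<^sub>v x) \<bullet>c y = x \<bullet>c (mat_adjoint A *\<^sub>v (y :: complex vec))"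
proof -
  have "(A *\<^sub>v x) \<bullet>c y = (\<Sum>i<m. \<Sum>j<n. A $$ (i, j) * x $ j * cnj (y $ i))"
    using assms by (auto simp: scalar_prod_def sum_distrib_right lessThan_atLeast0 intro!: sum.cong)
  also have "\<dots> = (\<Sum>j<n. \<Sum>i<m. A $$ (i, j) * x $ j * cnj (y $ i))"
    by (rule sum.swap)
  also have "\<dots> = x \<bullet>c (mat_adjoint A *\<^sub>v y)"
    using assms by (auto simp: scalar_prod_def sum_distrib_left lessThan_atLeast0 mat_adjoint_index
        intro!: sum.cong)
  finally show ?thesis .
qed

lemma cinner_adjoint':
  assumes "A \<in> carrier_mat m n" "x \<in> carrier_vec n" "y \<in> carrier_vec m"
  shows "y \<bullet>c (A *\<^sub>v x) = (mat_adjoint A *\<^sub>v y) \<bullet>c (x :: complex vec)"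
  using cinner_adjoint[of "mat_adjoint A" n m y x] assms by simp

lemma cinner_self: "v \<bullet>c v = complex_of_real ((euclid_norm v)\<^sup>2)"
proof -
  have "0 \<le> v \<bullet>c v" by (rule conjugate_square_ge_0_vec)
  then have "0 \<le> Re (v \<bullet>c v)" "Im (v \<bullet>c v) = 0" by (auto simp: less_eq_complex_def)
  then show ?thesis by (auto simp: euclid_norm_def complex_eq_iff)
qed

lemma euclid_norm_sq: "(euclid_norm v)\<^sup>2 = Re (v \<bullet>c v)"
  by (simp add: cinner_self)

lemma euclid_norm_nonneg [simp]: "0 \<le> euclid_norm v"
  using conjugate_square_ge_0_vec[of v] by (simp add: euclid_norm_def less_eq_complex_def)

lemma euclid_norm_eq_0_iff:
  assumes "v \<in> carrier_vec n"
  shows "euclid_norm v = 0 \<longleftrightarrow> v = 0\<^sub>v n"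
proof -
  have "euclid_norm v = 0 \<longleftrightarrow> v \<bullet>c v = 0" by (simp add: cinner_self)
  then show ?thesis using assms by simp
qed

lemma euclid_norm_zero [simp]: "euclid_norm (0\<^sub>v n) = 0"
  using euclid_norm_eq_0_iff[of "0\<^sub>v n" n] by simp

lemma euclid_norm_smult: "euclid_norm (c \<cdot>\<^sub>v v) = cmod c * euclid_norm v"
proof -
  have v: "v \<in> carrier_vec (dim_vec v)" and cv: "c \<cdot>\<^sub>v v \<in> carrier_vec (dim_vec v)" by auto
  have "(c \<cdot>\<^sub>v v) \<bullet>c (c \<cdot>\<^sub>v v) = (c * cnj c) * (v \<bullet>c v)"
    unfolding cinner_smult_left[OF v cv] cinner_smult_right[OF v v] by (rule mult.assoc[symmetric])
  also have "\<dots> = complex_of_real ((cmod c * euclid_norm v)\<^sup>2)"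
    unfolding complex_norm_square[symmetric] cinner_self by (simp add: power_mult_distrib)
  finally have "(euclid_norm (c \<cdot>\<^sub>v v))\<^sup>2 = (cmod c * euclid_norm v)\<^sup>2"
    unfolding cinner_self of_real_eq_iff .
  then show ?thesis by (rule power2_eq_imp_eq) auto
qed

lemma euclid_norm_add_sq:
  assumes v: "v \<in> carrier_vec n" and w: "w \<in> carrier_vec n"
  shows "(euclid_norm (v + w))\<^sup>2 = (euclid_norm v)\<^sup>2 + (euclid_norm w)\<^sup>2 + 2 * Re (v \<bullet>c w)"
  using assms cinner_commute[OF v w] by (simp add: euclid_norm_sq cinner_simps[of _ n])

lemma normalize_vec:
  assumes x: "x \<in> carrier_vec n" and "x \<noteq> 0\<^sub>v n"
  obtains y where "y \<in> carrier_vec n" "euclid_norm y = 1"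
    "x = complex_of_real (euclid_norm x) \<cdot>\<^sub>v y"
proof
  let ?y = "complex_of_real (1 / euclid_norm x) \<cdot>\<^sub>v x"
  have nz: "euclid_norm x \<noteq> 0" using assms by (simp add: euclid_norm_eq_0_iff)
  show "?y \<in> carrier_vec n" using x by simp
  show "euclid_norm ?y = 1" unfolding euclid_norm_smult using nz by (simp add: norm_divide)
  show "x = complex_of_real (euclid_norm x) \<cdot>\<^sub>v ?y"
    using nz by (simp add: smult_smult_assoc)
qed

section \<open>Extrema over the unit sphere\<close>

text \<open>Read as a set of coordinate functions, the sphere is a closed subset of a product of compact
  disks and singletons, which is compact by Tychonoff's theorem.\<close>

lemma compact_unit_sphere_coordinates:
  "compact {f :: nat \<Rightarrow> complex. (\<forall>i\<ge>n. f i = 0) \<and> (\<Sum>i<n. (cmod (f i))\<^sup>2) = 1}"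
proof -
  let ?K = "Pi\<^sub>E UNIV (\<lambda>i. if i < n then cball 0 1 else {0 :: complex})"
  let ?C = "{f :: nat \<Rightarrow> complex. (\<Sum>i<n. (cmod (f i))\<^sup>2) = 1}"
  have eq: "?K \<inter> ?C = {f. (\<forall>i\<ge>n. f i = 0) \<and> (\<Sum>i<n. (cmod (f i))\<^sup>2) = 1}"
  proof (rule equalityI; rule subsetI)
    fix f :: "nat \<Rightarrow> complex"
    assume f: "f \<in> ?K \<inter> ?C"
    then have K: "f \<in> ?K" by (rule IntD1)
    have "f i = 0" if "i \<ge> n" for i
      using PiE_mem[OF K UNIV_I, of i] that by simp
    then show "f \<in> {f. (\<forall>i\<ge>n. f i = 0) \<and> (\<Sum>i<n. (cmod (f i))\<^sup>2) = 1}" using f by auto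
  next
    fix f :: "nat \<Rightarrow> complex"
    assume f: "f \<in> {f. (\<forall>i\<ge>n. f i = 0) \<and> (\<Sum>i<n. (cmod (f i))\<^sup>2) = 1}"
    have "cmod (f i) \<le> 1" if "i < n" for i
    proof -
      have "(cmod (f i))\<^sup>2 \<le> (\<Sum>i<n. (cmod (f i))\<^sup>2)"
        using that by (intro member_le_sum) auto
      then show ?thesis using f by (simp add: power_le_one_iff)
    qed
    then show "f \<in> ?K \<inter> ?C" using f by (auto simp: PiE_def Pi_def)
  qed
  have "compactin (product_topology (\<lambda>i. euclidean) UNIV) ?K"
    by (subst compactin_PiE) (auto simp: compact_cball)
  then have "compact ?K" by (simp add: euclidean_product_topology)
  moreover have "closed ?C"
    by (intro closed_Collect_eq continuous_on_sum continuous_on_power continuous_on_norm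
        continuous_on_const continuous_on_product_coordinates)
  ultimately have "compact (?K \<inter> ?C)" by (rule compact_Int_closed)
  then show ?thesis by (simp only: eq)
qed

text \<open>Both the square of the operator norm (through the form of \<open>A\<^sup>* A\<close>, with \<open>g = Re\<close>) and the
  numerical radius (with \<open>g = cmod\<close>) are maxima of this kind.\<close>

lemma quadratic_form_attains_max:
  fixes g :: "complex \<Rightarrow> real"
  assumes M: "M \<in> carrier_mat n n" and "n > 0" and g: "continuous_on UNIV g"
  obtains v where "v \<in> carrier_vec n" "euclid_norm v = 1"
    "\<And>z. z \<in> carrier_vec n \<Longrightarrow> euclid_norm z = 1 \<Longrightarrow> g ((M *\<^sub>v z) \<bullet>c z) \<le> g ((M *\<^sub>v v) \<bullet>c v)"
proof -
  let ?S = "{f :: nat \<Rightarrow> complex. (\<forall>i\<ge>n. f i = 0) \<and> (\<Sum>i<n. (cmod (f i))\<^sup>2) = 1}"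
  define q where "q f = g (\<Sum>i<n. (\<Sum>j<n. M $$ (i, j) * f j) * cnj (f i))" for f :: "nat \<Rightarrow> complex"
  have q_eq: "g ((M *\<^sub>v z) \<bullet>c z) = q (\<lambda>i. if i < n then z $ i else 0)" if "z \<in> carrier_vec n" for z
    using that M unfolding q_def
    by (intro arg_cong[where f = g]) (auto simp: scalar_prod_def lessThan_atLeast0 intro!: sum.cong)
  have nrm: "(euclid_norm z)\<^sup>2 = (\<Sum>i<n. (cmod (z $ i))\<^sup>2)" if "z \<in> carrier_vec n" for z
    using that unfolding euclid_norm_sq
    by (simp add: scalar_prod_def lessThan_atLeast0 cmod_power2 Re_sum flip: power2_eq_square)
  have mem: "(\<lambda>i. if i < n then z $ i else 0) \<in> ?S"
    if "z \<in> carrier_vec n" "euclid_norm z = 1" for z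
    using nrm[OF that(1)] that(2) by simp
  have "(\<lambda>i. if i = 0 then 1 else 0) \<in> ?S"
    using \<open>n > 0\<close> by (auto simp: if_distrib[of "\<lambda>x. (cmod x)\<^sup>2"] sum.delta cong: if_cong)
  then have ne: "?S \<noteq> {}" by (metis empty_iff)
  have cont: "continuous_on ?S q"
    unfolding q_def
  proof (rule continuous_on_compose2[OF g])
    show "continuous_on ?S (\<lambda>f. \<Sum>i<n. (\<Sum>j<n. M $$ (i, j) * f j) * cnj (f i))"
      by (rule continuous_on_subset[OF _ subset_UNIV])
        (intro continuous_on_sum continuous_on_mult continuous_on_const continuous_on_cnj
          continuous_on_product_coordinates)
  qed (rule subset_UNIV)
  have "\<exists>f\<in>?S. \<forall>h\<in>?S. q h \<le> q f"
    by (rule continuous_attains_sup[OF compact_unit_sphere_coordinates ne cont])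
  then obtain f where f: "f \<in> ?S" "\<And>h. h \<in> ?S \<Longrightarrow> q h \<le> q f"
    by (elim bexE) (rule that, assumption, erule bspec)
  have c: "vec n f \<in> carrier_vec n" by simp
  have ff: "(\<lambda>i. if i < n then vec n f $ i else 0) = f"
    using f(1) by (intro ext) simp
  show thesis
  proof
    show "vec n f \<in> carrier_vec n" by simp
    have "(euclid_norm (vec n f))\<^sup>2 = 1" using nrm[OF c] f(1) by simp
    then show "euclid_norm (vec n f) = 1"
      using euclid_norm_nonneg[of "vec n f"] by (simp add: power2_eq_1_iff)
    fix z :: "complex vec" assume z: "z \<in> carrier_vec n" "euclid_norm z = 1"
    show "g ((M *\<^sub>v z) \<bullet>c z) \<le> g ((M *\<^sub>v vec n f) \<bullet>c vec n f)"
      unfolding q_eq[OF z(1)] q_eq[OF c] ff by (rule f(2)[OF mem[OF z]])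
  qed
qed

lemma smult_mat_mult_vec:
  assumes "A \<in> carrier_mat m n" "v \<in> carrier_vec n"
  shows "(c \<cdot>\<^sub>m A) *\<^sub>v v = c \<cdot>\<^sub>v (A *\<^sub>v (v :: complex vec))"
  using assms by (intro eq_vecI) (auto simp: scalar_prod_def sum_distrib_left mult.assoc)

lemma op_norm_attained:
  assumes A: "A \<in> carrier_mat n n" and n: "n > 0"
  obtains v where "v \<in> carrier_vec n" "euclid_norm v = 1" "euclid_norm (A *\<^sub>v v) = op_norm A"
    "\<And>x. x \<in> carrier_vec n \<Longrightarrow> euclid_norm (A *\<^sub>v x) \<le> op_norm A * euclid_norm x"
proof -
  have M: "mat_adjoint A * A \<in> carrier_mat n n" using A by (intro mult_carrier_mat mat_adjoint_carrier)
  have sq: "(euclid_norm (A *\<^sub>v x))\<^sup>2 = Re ((mat_adjoint A * A *\<^sub>v x) \<bullet>c x)"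
    if x: "x \<in> carrier_vec n" for x
  proof -
    have Ax: "A *\<^sub>v x \<in> carrier_vec n" using A x by simp
    have "mat_adjoint A * A *\<^sub>v x = mat_adjoint A *\<^sub>v (A *\<^sub>v x)"
      using A x by (intro assoc_mult_mat_vec mat_adjoint_carrier)
    then show ?thesis unfolding euclid_norm_sq by (simp only: cinner_adjoint'[OF A x Ax])
  qed
  obtain v where v: "v \<in> carrier_vec n" "euclid_norm v = 1"
    and max: "\<And>z. z \<in> carrier_vec n \<Longrightarrow> euclid_norm z = 1 \<Longrightarrow>
      Re ((mat_adjoint A * A *\<^sub>v z) \<bullet>c z) \<le> Re ((mat_adjoint A * A *\<^sub>v v) \<bullet>c v)"
    using quadratic_form_attains_max[OF M n continuous_on_Re[OF continuous_on_id]] by metis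
  let ?t = "euclid_norm (A *\<^sub>v v)"
  have unit: "euclid_norm (A *\<^sub>v z) \<le> ?t" if "z \<in> carrier_vec n" "euclid_norm z = 1" for z
    using max[OF that] sq[OF that(1)] sq[OF v(1)] by (auto intro: power2_le_imp_le)
  have bound: "euclid_norm (A *\<^sub>v x) \<le> ?t * euclid_norm x" if x: "x \<in> carrier_vec n" for x
  proof (cases "x = 0\<^sub>v n")
    case True
    then have "A *\<^sub>v x = 0\<^sub>v n" using A by auto
    then show ?thesis using True by simp
  next
    case False
    obtain y where y: "y \<in> carrier_vec n" "euclid_norm y = 1"
      and xy: "x = complex_of_real (euclid_norm x) \<cdot>\<^sub>v y"
      using normalize_vec[OF x False] .
    have "A *\<^sub>v x = complex_of_real (euclid_norm x) \<cdot>\<^sub>v (A *\<^sub>v y)"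
      by (subst xy) (rule mult_mat_vec[OF A y(1)])
    then have "euclid_norm (A *\<^sub>v x) = euclid_norm x * euclid_norm (A *\<^sub>v y)"
      by (simp add: euclid_norm_smult)
    then show ?thesis
      using mult_left_mono[OF unit[OF y] euclid_norm_nonneg[of x]] by (simp add: mult.commute)
  qed
  have "op_norm A = ?t"
    unfolding op_norm_def
  proof (rule cSup_eq_maximum)
    show "?t \<in> {euclid_norm (A *\<^sub>v x) |x. x \<in> carrier_vec (dim_col A) \<and> euclid_norm x \<le> 1}"
      using v A by auto
    fix y assume "y \<in> {euclid_norm (A *\<^sub>v x) |x. x \<in> carrier_vec (dim_col A) \<and> euclid_norm x \<le> 1}"
    then obtain x where x: "y = euclid_norm (A *\<^sub>v x)" "x \<in> carrier_vec n" "euclid_norm x \<le> 1"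
      using A by auto
    have "?t * euclid_norm x \<le> ?t * 1" using x(3) by (intro mult_left_mono) auto
    then show "y \<le> ?t" using bound[OF x(2)] x(1) by simp
  qed
  then show thesis using that[OF v] bound by simp
qed

lemma op_norm_bound:
  assumes "A \<in> carrier_mat n n" "n > 0" "x \<in> carrier_vec n"
  shows "euclid_norm (A *\<^sub>v x) \<le> op_norm A * euclid_norm x"
  using op_norm_attained[OF assms(1,2)] assms(3) by metis

lemma num_radius_bdd_above:
  assumes A: "A \<in> carrier_mat n n" and n: "n > 0"
  shows "bdd_above {cmod ((A *\<^sub>v z) \<bullet>c z) |z. z \<in> carrier_vec (dim_col A) \<and> euclid_norm z = 1}"
proof -
  obtain v where "\<And>z. z \<in> carrier_vec n \<Longrightarrow> euclid_norm z = 1 \<Longrightarrow>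
      cmod ((A *\<^sub>v z) \<bullet>c z) \<le> cmod ((A *\<^sub>v v) \<bullet>c v)"
    using quadratic_form_attains_max[OF A n continuous_on_norm[OF continuous_on_id]] by metis
  then show ?thesis using A by (intro bdd_aboveI[of _ "cmod ((A *\<^sub>v v) \<bullet>c v)"]) auto
qed

lemma num_radius_upper:
  assumes A: "A \<in> carrier_mat n n" and n: "n > 0" and z: "z \<in> carrier_vec n" "euclid_norm z = 1"
  shows "cmod ((A *\<^sub>v z) \<bullet>c z) \<le> num_radius A"
  unfolding num_radius_def
  by (rule cSup_upper[OF _ num_radius_bdd_above[OF A n]]) (use A z in auto)

lemma num_radius_least:
  assumes A: "A \<in> carrier_mat n n" and n: "n > 0"
    and le: "\<And>z. z \<in> carrier_vec n \<Longrightarrow> euclid_norm z = 1 \<Longrightarrow> cmod ((A *\<^sub>v z) \<bullet>c z) \<le> c"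
  shows "num_radius A \<le> c"
  unfolding num_radius_def
proof (rule cSup_least)
  obtain v where "v \<in> carrier_vec n" "euclid_norm v = 1"
    using op_norm_attained[OF A n] .
  then show "{cmod ((A *\<^sub>v z) \<bullet>c z) |z. z \<in> carrier_vec (dim_col A) \<and> euclid_norm z = 1} \<noteq> {}"
    using A by auto
qed (use le A in auto)

lemma num_radius_bound:
  assumes A: "A \<in> carrier_mat n n" and n: "n > 0" and x: "x \<in> carrier_vec n"
  shows "cmod ((A *\<^sub>v x) \<bullet>c x) \<le> num_radius A * (euclid_norm x)\<^sup>2"
proof (cases "x = 0\<^sub>v n")
  case True
  then have "A *\<^sub>v x = 0\<^sub>v n" using A by auto
  then show ?thesis using True by simp
next
  case False
  obtain y where y: "y \<in> carrier_vec n" "euclid_norm y = 1"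
    and xy: "x = complex_of_real (euclid_norm x) \<cdot>\<^sub>v y"
    using normalize_vec[OF x False] .
  have Ay: "A *\<^sub>v y \<in> carrier_vec n" using A y by simp
  have "(A *\<^sub>v x) \<bullet>c x = complex_of_real ((euclid_norm x)\<^sup>2) * ((A *\<^sub>v y) \<bullet>c y)"
    using cinner_smult_left[of "A *\<^sub>v y" n "complex_of_real (euclid_norm x) \<cdot>\<^sub>v y"]
      cinner_smult_right[OF y(1) Ay] y Ay
    by (subst (1 2) xy) (simp add: mult_mat_vec[OF A y(1)] power2_eq_square)
  then have "cmod ((A *\<^sub>v x) \<bullet>c x) = (euclid_norm x)\<^sup>2 * cmod ((A *\<^sub>v y) \<bullet>c y)"
    by (simp add: norm_mult norm_power)
  then show ?thesis
    using mult_left_mono[OF num_radius_upper[OF A n y], of "(euclid_norm x)\<^sup>2"]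
    by (simp add: mult.commute)
qed

section \<open>Positive semidefinite forms and the maximal singular subspace\<close>

text \<open>A zero of a nonnegative form is a minimum, so the derivative of the form vanishes there. Moving
  from \<open>z\<close> in the direction \<open>- M z\<close> changes the form by \<open>- 2 t \<parallel>M z\<parallel>\<^sup>2 + O(t\<^sup>2)\<close>, which is negative for
  small \<open>t > 0\<close> unless \<open>M z = 0\<close>.\<close>

lemma psd_form_zero_imp_kernel:
  assumes M: "M \<in> carrier_mat n n" and herm: "mat_adjoint M = M"
    and psd: "\<And>w. w \<in> carrier_vec n \<Longrightarrow> 0 \<le> Re ((M *\<^sub>v w) \<bullet>c w)"
    and z: "z \<in> carrier_vec n" and zero: "Re ((M *\<^sub>v z) \<bullet>c z) = 0"
  shows "M *\<^sub>v z = 0\<^sub>v n"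
proof (rule ccontr)
  let ?g = "M *\<^sub>v z"
  assume "?g \<noteq> 0\<^sub>v n"
  have g: "?g \<in> carrier_vec n" and Mg: "M *\<^sub>v ?g \<in> carrier_vec n" using M z by auto
  define a where "a = (euclid_norm ?g)\<^sup>2"
  define k where "k = Re ((M *\<^sub>v ?g) \<bullet>c ?g)"
  have a: "a > 0" using \<open>?g \<noteq> 0\<^sub>v n\<close> g by (simp add: a_def euclid_norm_eq_0_iff)
  have k: "k \<ge> 0" unfolding k_def by (rule psd[OF g])
  have quad: "0 \<le> t\<^sup>2 * k - 2 * t * a" for t :: real
  proof -
    let ?c = "- complex_of_real t"
    let ?w = "z + ?c \<cdot>\<^sub>v ?g"
    have cg: "?c \<cdot>\<^sub>v ?g \<in> carrier_vec n" and w: "?w \<in> carrier_vec n" using g z by auto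
    have Mw: "M *\<^sub>v ?w = ?g + ?c \<cdot>\<^sub>v (M *\<^sub>v ?g)"
      unfolding mult_add_distrib_mat_vec[OF M z cg] mult_mat_vec[OF M g] ..
    have swap: "(M *\<^sub>v ?g) \<bullet>c z = ?g \<bullet>c ?g"
      using cinner_adjoint[OF M g z] by (simp only: herm)
    have "(M *\<^sub>v ?w) \<bullet>c ?w = ?g \<bullet>c z - 2 * complex_of_real t * (?g \<bullet>c ?g)
        + (complex_of_real t)\<^sup>2 * ((M *\<^sub>v ?g) \<bullet>c ?g)"
      unfolding Mw using g z Mg cg
      by (simp add: cinner_simps[of _ n] swap power2_eq_square algebra_simps)
    then have "Re ((M *\<^sub>v ?w) \<bullet>c ?w) = t\<^sup>2 * k - 2 * t * a"
      using zero by (simp add: a_def k_def cinner_self power2_eq_square)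
    then show ?thesis using psd[OF w] by simp
  qed
  \<comment> \<open>The linear term has to win; dividing by \<open>k + 1\<close> rather than \<open>k\<close> covers \<open>k = 0\<close>.\<close>
  define t where "t = a / (k + 1)"
  have t: "t > 0" and at: "a = t * (k + 1)" using a k by (auto simp: t_def)
  have "0 \<le> t\<^sup>2 * k - 2 * t * a" by (rule quad)
  also have "\<dots> = t\<^sup>2 * (- k - 2)" by (simp add: at power2_eq_square algebra_simps)
  also have "\<dots> < 0" using t k by (intro mult_pos_neg) auto
  finally show False by simp
qed

text \<open>The defining equation of \<^const>\<open>V_max\<close> is not linear. It says that the nonnegative form of
  \<open>\<parallel>A\<parallel>\<^sup>2 I - A\<^sup>* A\<close> vanishes at \<open>x\<close>, and so it is equivalent to membership in the kernel of this matrix;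
  this is why \<^const>\<open>V_max\<close> is a subspace at all.\<close>

lemma V_max_iff_eigenvector:
  assumes A: "A \<in> carrier_mat n n" and n: "n > 0"
  shows "x \<in> V_max A \<longleftrightarrow> x \<in> carrier_vec n \<and>
    mat_adjoint A *\<^sub>v (A *\<^sub>v x) = complex_of_real ((op_norm A)\<^sup>2) \<cdot>\<^sub>v x"
    and "V_max A = mat_kernel (complex_of_real ((op_norm A)\<^sup>2) \<cdot>\<^sub>m 1\<^sub>m n - mat_adjoint A * A)"
proof -
  let ?s = "op_norm A"
  define M where "M = complex_of_real (?s\<^sup>2) \<cdot>\<^sub>m 1\<^sub>m n - mat_adjoint A * A"
  have AA: "mat_adjoint A * A \<in> carrier_mat n n" using A by (intro mult_carrier_mat mat_adjoint_carrier)
  have M: "M \<in> carrier_mat n n" unfolding M_def by (rule minus_carrier_mat[OF AA])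
  have herm: "mat_adjoint M = M"
    by (rule eq_matI)
      (use A in \<open>auto simp: M_def mat_adjoint_index scalar_prod_def mult.commute intro!: sum.cong\<close>)
  have Mx: "M *\<^sub>v x = complex_of_real (?s\<^sup>2) \<cdot>\<^sub>v x - mat_adjoint A *\<^sub>v (A *\<^sub>v x)"
    if x: "x \<in> carrier_vec n" for x
    unfolding M_def using x A AA
    by (simp add: minus_mult_distrib_mat_vec[of _ n n] smult_mat_mult_vec[of _ n n]
        assoc_mult_mat_vec[OF mat_adjoint_carrier[OF A] A x])
  have form: "Re ((M *\<^sub>v x) \<bullet>c x) = (?s * euclid_norm x)\<^sup>2 - (euclid_norm (A *\<^sub>v x))\<^sup>2"
    if x: "x \<in> carrier_vec n" for x
  proof -
    have Ax: "A *\<^sub>v x \<in> carrier_vec n" and AAx: "mat_adjoint A *\<^sub>v (A *\<^sub>v x) \<in> carrier_vec n"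
      using A x by auto
    have "(M *\<^sub>v x) \<bullet>c x = complex_of_real (?s\<^sup>2) * (x \<bullet>c x) - (A *\<^sub>v x) \<bullet>c (A *\<^sub>v x)"
      unfolding Mx[OF x] cinner_adjoint'[OF A x Ax] using x AAx
      by (simp add: minus_scalar_prod_distrib[of _ n])
    then show ?thesis by (simp add: cinner_self power_mult_distrib)
  qed
  have psd: "0 \<le> Re ((M *\<^sub>v w) \<bullet>c w)" if w: "w \<in> carrier_vec n" for w
    unfolding form[OF w] using op_norm_bound[OF A n w] by (simp add: power_mono)
  have "x \<in> V_max A \<longleftrightarrow> M *\<^sub>v x = 0\<^sub>v n" if x: "x \<in> carrier_vec n" for x
  proof
    assume "x \<in> V_max A"
    then have "Re ((M *\<^sub>v x) \<bullet>c x) = 0" unfolding form[OF x] by (simp add: V_max_def)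
    then show "M *\<^sub>v x = 0\<^sub>v n" by (intro psd_form_zero_imp_kernel[OF M herm _ x] psd)
  next
    assume "M *\<^sub>v x = 0\<^sub>v n"
    then have "(euclid_norm (A *\<^sub>v x))\<^sup>2 = (?s * euclid_norm x)\<^sup>2"
      using form[OF x] x by simp
    moreover have "0 \<le> ?s * euclid_norm x"
      using op_norm_bound[OF A n x] euclid_norm_nonneg order_trans by blast
    ultimately show "x \<in> V_max A"
      using x A by (auto simp: V_max_def power2_eq_iff_nonneg)
  qed
  moreover have "V_max A \<subseteq> carrier_vec n" using A by (auto simp: V_max_def)
  ultimately have ker: "x \<in> V_max A \<longleftrightarrow> x \<in> carrier_vec n \<and> M *\<^sub>v x = 0\<^sub>v n" for x by blast
  then show "V_max A = mat_kernel (complex_of_real (?s\<^sup>2) \<cdot>\<^sub>m 1\<^sub>m n - mat_adjoint A * A)"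
    using mat_kernel[OF M] unfolding M_def by blast
  show "x \<in> V_max A \<longleftrightarrow> x \<in> carrier_vec n \<and>
    mat_adjoint A *\<^sub>v (A *\<^sub>v x) = complex_of_real (?s\<^sup>2) \<cdot>\<^sub>v x"
  proof -
    have "M *\<^sub>v x = 0\<^sub>v n \<longleftrightarrow> mat_adjoint A *\<^sub>v (A *\<^sub>v x) = complex_of_real (?s\<^sup>2) \<cdot>\<^sub>v x"
      if x: "x \<in> carrier_vec n"
    proof -
      have AAx: "mat_adjoint A *\<^sub>v (A *\<^sub>v x) \<in> carrier_vec n"
        using A x by auto
      show ?thesis unfolding Mx[OF x] using x AAx
        by (auto simp: vec_eq_iff)
    qed
    then show ?thesis using ker by blast
  qed
qed

section \<open>Probing the numerical range with singular vectors\<close>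

lemma op_norm_pos:
  assumes A: "A \<in> carrier_mat n n" and "A \<noteq> 0\<^sub>m n n"
  shows "n > 0" and "op_norm A > 0"
proof -
  show n: "n > 0" using assms by (auto intro!: eq_matI)
  have ge: "0 \<le> op_norm A"
    using op_norm_attained[OF A n] euclid_norm_nonneg by metis
  moreover have "op_norm A \<noteq> 0"
  proof
    assume z: "op_norm A = 0"
    have Ax: "A *\<^sub>v x = 0\<^sub>v n" if x: "x \<in> carrier_vec n" for x
    proof -
      have "euclid_norm (A *\<^sub>v x) = 0"
        using op_norm_bound[OF A n x] euclid_norm_nonneg[of "A *\<^sub>v x"] z by simp
      then show ?thesis using A x euclid_norm_eq_0_iff[of "A *\<^sub>v x" n] by simp
    qed
    have "A = 0\<^sub>m n n"
    proof (rule eq_matI)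
      fix i j assume ij: "i < dim_row (0\<^sub>m n n :: complex mat)" "j < dim_col (0\<^sub>m n n :: complex mat)"
      then have "A $$ (i, j) = (A *\<^sub>v unit_vec n j) $ i" using A by simp
      also have "\<dots> = 0" using Ax[of "unit_vec n j"] ij by simp
      finally show "A $$ (i, j) = 0\<^sub>m n n $$ (i, j)" using ij by simp
    qed (use A in auto)
    then show False using assms by simp
  qed
  ultimately show "op_norm A > 0" by simp
qed

text \<open>A unit vector \<open>v\<close> that is stretched maximally, together with its normalized image \<open>u\<close>:
  \<open>A v = s u\<close> and \<open>A\<^sup>* u = s v\<close>, where \<open>s = \<parallel>A\<parallel>\<close>.\<close>

locale max_singular_vector =
  fixes A :: "complex mat" and n :: nat and v :: "complex vec"
  assumes A: "A \<in> carrier_mat n n" and nonzero: "A \<noteq> 0\<^sub>m n n"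
    and v_max: "v \<in> V_max A" and v_unit: "euclid_norm v = 1"
begin

abbreviation s where "s \<equiv> op_norm A"
abbreviation u where "u \<equiv> normalized_image A v"

lemmas n_pos = op_norm_pos(1)[OF A nonzero] and s_pos = op_norm_pos(2)[OF A nonzero]

lemma v_carrier [simp]: "v \<in> carrier_vec n"
  using v_max A by (simp add: V_max_def)

lemma u_carrier [simp]: "u \<in> carrier_vec n"
  using A by (simp add: normalized_image_def)

lemma images_carrier [simp]:
  "x \<in> carrier_vec n \<Longrightarrow> A *\<^sub>v x \<in> carrier_vec n" "mat_adjoint A *\<^sub>v x \<in> carrier_vec n"
  using A by auto

lemma A_v: "A *\<^sub>v v = complex_of_real s \<cdot>\<^sub>v u"
  using s_pos by (simp add: normalized_image_def smult_smult_assoc)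

lemma u_unit: "euclid_norm u = 1"
  using v_max v_unit s_pos
  by (simp add: normalized_image_def euclid_norm_smult V_max_def norm_divide)

lemma adjoint_u: "mat_adjoint A *\<^sub>v u = complex_of_real s \<cdot>\<^sub>v v"
proof -
  have "mat_adjoint A *\<^sub>v u = complex_of_real (1 / s) \<cdot>\<^sub>v (mat_adjoint A *\<^sub>v (A *\<^sub>v v))"
    unfolding normalized_image_def by (rule mult_mat_vec[OF mat_adjoint_carrier[OF A]]) simp
  then show ?thesis
    using v_max s_pos V_max_iff_eigenvector(1)[OF A n_pos, of v]
    by (simp add: smult_smult_assoc power2_eq_square)
qed

lemma unit_inner [simp]: "v \<bullet>c v = 1" "u \<bullet>c u = 1"
  by (simp_all add: cinner_self v_unit u_unit)

lemma v_in_range_adjoint: "v \<in> mat_range (mat_adjoint A)"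
proof -
  have "v = mat_adjoint A *\<^sub>v (complex_of_real (1 / s) \<cdot>\<^sub>v u)"
    using s_pos mult_mat_vec[OF mat_adjoint_carrier[OF A] u_carrier]
    by (simp add: adjoint_u smult_smult_assoc)
  then show ?thesis unfolding mat_range_def using A by (intro image_eqI) auto
qed

text \<open>The factor \<open>\<phi>\<close> turns the form on the test vectors \<open>v + \<phi> u\<close> into a polynomial in \<open>\<phi>\<close>. The real part
  of its first summand is \<open>s / 2\<close> times the squared norm of the test vector; the other summand
  averages to zero over suitable phases.\<close>

lemma phase_identity:
  assumes phi: "cmod \<phi> = 1"
  shows "\<phi> * ((A *\<^sub>v (v + \<phi> \<cdot>\<^sub>v u)) \<bullet>c (v + \<phi> \<cdot>\<^sub>v u)) =
      s * (1 + \<phi> * (u \<bullet>c v)) + (\<phi>\<^sup>2 * ((A *\<^sub>v u) \<bullet>c v) + \<phi> * ((A *\<^sub>v u) \<bullet>c u))"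
    and "(euclid_norm (v + \<phi> \<cdot>\<^sub>v u))\<^sup>2 = 2 * (1 + Re (\<phi> * (u \<bullet>c v)))"
proof -
  let ?z = "v + \<phi> \<cdot>\<^sub>v u"
  let ?c = "(A *\<^sub>v u) \<bullet>c v" and ?d = "(A *\<^sub>v u) \<bullet>c u"
  have pp: "\<phi> * cnj \<phi> = 1" using phi by (simp add: complex_norm_square[symmetric])
  have Az: "A *\<^sub>v ?z = complex_of_real s \<cdot>\<^sub>v u + \<phi> \<cdot>\<^sub>v (A *\<^sub>v u)"
    using A by (simp add: mult_add_distrib_mat_vec[of _ n n] mult_mat_vec[of _ n n] A_v)
  have "\<phi> * ((A *\<^sub>v ?z) \<bullet>c ?z) = s * \<phi> * (u \<bullet>c v) + s * (\<phi> * cnj \<phi>) + \<phi>\<^sup>2 * ?c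
      + \<phi> * (\<phi> * cnj \<phi>) * ?d"
    unfolding Az by (simp add: cinner_simps[of _ n] power2_eq_square algebra_simps)
  then show "\<phi> * ((A *\<^sub>v ?z) \<bullet>c ?z) = s * (1 + \<phi> * (u \<bullet>c v)) + (\<phi>\<^sup>2 * ?c + \<phi> * ?d)"
    unfolding pp by (simp add: algebra_simps)
  have "v \<bullet>c (\<phi> \<cdot>\<^sub>v u) = cnj (\<phi> * (u \<bullet>c v))"
    using cinner_commute[of u n v] by (simp add: cinner_simps[of _ n])
  then show "(euclid_norm ?z)\<^sup>2 = 2 * (1 + Re (\<phi> * (u \<bullet>c v)))"
    using euclid_norm_add_sq[of v n "\<phi> \<cdot>\<^sub>v u"] phi
    by (simp add: v_unit u_unit euclid_norm_smult)
qed

text \<open>Compares the real part of the form with \<open>r(A)\<close> times the squared norm, by \<open>phase_identity\<close>. The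
  left-hand side has mean zero over the phases \<open>1, -1, \<i>, -\<i>\<close> and the bracket on the right has
  mean one.\<close>

lemma phase_inequality:
  assumes phi: "cmod \<phi> = 1"
  shows "Re (\<phi>\<^sup>2 * ((A *\<^sub>v u) \<bullet>c v) + \<phi> * ((A *\<^sub>v u) \<bullet>c u))
    \<le> (2 * num_radius A - s) * (1 + Re (\<phi> * (u \<bullet>c v)))"
proof -
  let ?z = "v + \<phi> \<cdot>\<^sub>v u" and ?e = "\<phi>\<^sup>2 * ((A *\<^sub>v u) \<bullet>c v) + \<phi> * ((A *\<^sub>v u) \<bullet>c u)"
  have z: "?z \<in> carrier_vec n" by simp
  have "s * (1 + Re (\<phi> * (u \<bullet>c v))) + Re ?e = Re (\<phi> * ((A *\<^sub>v ?z) \<bullet>c ?z))"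
    unfolding phase_identity(1)[OF phi] plus_complex.sel(1) by simp
  also have "\<dots> \<le> cmod (\<phi> * ((A *\<^sub>v ?z) \<bullet>c ?z))" by (rule complex_Re_le_cmod)
  also have "\<dots> = cmod ((A *\<^sub>v ?z) \<bullet>c ?z)" using phi by (simp add: norm_mult)
  also have "\<dots> \<le> num_radius A * (2 * (1 + Re (\<phi> * (u \<bullet>c v))))"
    using num_radius_bound[OF A n_pos z] unfolding phase_identity(2)[OF phi] .
  finally show ?thesis unfolding left_diff_distrib by linarith
qed

lemma op_norm_le_twice_num_radius: "s \<le> 2 * num_radius A"
  using phase_inequality[of 1] phase_inequality[of "-1"]
    phase_inequality[of \<i>] phase_inequality[of "-\<i>"]
  by (simp add: algebra_simps)

text \<open>If \<open>s = 2 r(A)\<close>, the right-hand side of \<open>phase_inequality\<close> vanishes, and a function of mean zero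
  that is nowhere positive is zero. Hence \<open>v + u\<close> and \<open>v - u\<close> are zeros of the forms of
  \<open>s I - p (A + A\<^sup>*)\<close> with \<open>p = 1\<close> and \<open>p = -1\<close> respectively. These forms are nonnegative because
  \<open>r(A) = s / 2\<close>, so the two vectors lie in the kernels of the matrices. The two kernel equations are
  \<open>A u + p A\<^sup>* v = 0\<close>, and together they give the claim.\<close>

lemma extremal_imp_annihilated:
  assumes eq: "s = 2 * num_radius A"
  shows "A *\<^sub>v u = 0\<^sub>v n" and "mat_adjoint A *\<^sub>v v = 0\<^sub>v n"
proof -
  let ?c = "(A *\<^sub>v u) \<bullet>c v" and ?d = "(A *\<^sub>v u) \<bullet>c u"
  have cd: "Re ?c = 0" "Re ?d = 0"
    using phase_inequality[of 1] phase_inequality[of "-1"]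
      phase_inequality[of \<i>] phase_inequality[of "-\<i>"] eq
    by (simp_all add: power2_eq_square)
  have sum0: "A *\<^sub>v u + p \<cdot>\<^sub>v (mat_adjoint A *\<^sub>v v) = 0\<^sub>v n" if p: "p = 1 \<or> p = -1" for p :: complex
  proof -
    let ?z = "v + p \<cdot>\<^sub>v u"
    define M where "M = complex_of_real s \<cdot>\<^sub>m 1\<^sub>m n - p \<cdot>\<^sub>m (A + mat_adjoint A)"
    have S: "A + mat_adjoint A \<in> carrier_mat n n" using A by simp
    have M: "M \<in> carrier_mat n n" unfolding M_def by (intro minus_carrier_mat smult_carrier_mat S)
    have pp: "p * p = 1" "cnj p = p" "cmod p = 1" using p by auto
    have herm: "mat_adjoint M = M"
      by (rule eq_matI)
        (use A pp in \<open>auto simp: M_def mat_adjoint_index algebra_simps\<close>)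
    have Mw: "M *\<^sub>v w = complex_of_real s \<cdot>\<^sub>v w - p \<cdot>\<^sub>v (A *\<^sub>v w + mat_adjoint A *\<^sub>v w)"
      if w: "w \<in> carrier_vec n" for w
      unfolding M_def using w A S
      by (simp add: minus_mult_distrib_mat_vec[of _ n n] smult_mat_mult_vec[of _ n n]
          add_mult_distrib_mat_vec[of _ n n])
    have form: "Re ((M *\<^sub>v w) \<bullet>c w) = s * (euclid_norm w)\<^sup>2 - 2 * Re (p * ((A *\<^sub>v w) \<bullet>c w))"
      if w: "w \<in> carrier_vec n" for w
    proof -
      have "(mat_adjoint A *\<^sub>v w) \<bullet>c w = cnj ((A *\<^sub>v w) \<bullet>c w)"
        using cinner_adjoint'[OF A w w] cinner_commute[of "A *\<^sub>v w" n w] w by simp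
      then have "(M *\<^sub>v w) \<bullet>c w = complex_of_real s * (w \<bullet>c w)
          - (p * ((A *\<^sub>v w) \<bullet>c w) + cnj (p * ((A *\<^sub>v w) \<bullet>c w)))"
        unfolding Mw[OF w] using w pp
        by (simp add: minus_scalar_prod_distrib[of _ n] cinner_simps[of _ n] algebra_simps)
      then show ?thesis by (simp add: cinner_self)
    qed
    have psd: "0 \<le> Re ((M *\<^sub>v w) \<bullet>c w)" if w: "w \<in> carrier_vec n" for w
    proof -
      have "Re (p * ((A *\<^sub>v w) \<bullet>c w)) \<le> cmod (p * ((A *\<^sub>v w) \<bullet>c w))" by (rule complex_Re_le_cmod)
      also have "\<dots> = cmod ((A *\<^sub>v w) \<bullet>c w)" using pp by (simp add: norm_mult)
      also have "\<dots> \<le> num_radius A * (euclid_norm w)\<^sup>2" by (rule num_radius_bound[OF A n_pos w])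
      finally show ?thesis unfolding form[OF w] using eq by simp
    qed
    have z: "?z \<in> carrier_vec n" by simp
    have Mz: "M *\<^sub>v ?z = - (A *\<^sub>v u + p \<cdot>\<^sub>v (mat_adjoint A *\<^sub>v v))"
    proof -
      have Az: "A *\<^sub>v ?z = complex_of_real s \<cdot>\<^sub>v u + p \<cdot>\<^sub>v (A *\<^sub>v u)"
        using A by (simp add: mult_add_distrib_mat_vec[of _ n n] mult_mat_vec[of _ n n] A_v)
      have "mat_adjoint A *\<^sub>v ?z = mat_adjoint A *\<^sub>v v + p \<cdot>\<^sub>v (complex_of_real s \<cdot>\<^sub>v v)"
        using A by (simp add: mult_add_distrib_mat_vec[of _ n n] mult_mat_vec[of _ n n] adjoint_u)
      moreover have "complex_of_real s \<cdot>\<^sub>v (v + p \<cdot>\<^sub>v u)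
          - p \<cdot>\<^sub>v (complex_of_real s \<cdot>\<^sub>v u + p \<cdot>\<^sub>v a + (b + p \<cdot>\<^sub>v (complex_of_real s \<cdot>\<^sub>v v)))
          = - (a + p \<cdot>\<^sub>v b)" if "a \<in> carrier_vec n" "b \<in> carrier_vec n" for a b
      proof (rule eq_vecI)
        fix i assume "i < dim_vec (- (a + p \<cdot>\<^sub>v b))"
        then have i: "i < n" using that by simp
        show "(complex_of_real s \<cdot>\<^sub>v (v + p \<cdot>\<^sub>v u)
          - p \<cdot>\<^sub>v (complex_of_real s \<cdot>\<^sub>v u + p \<cdot>\<^sub>v a + (b + p \<cdot>\<^sub>v (complex_of_real s \<cdot>\<^sub>v v)))) $ i
          = (- (a + p \<cdot>\<^sub>v b)) $ i"
          using i p that v_carrier u_carrier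
          by (elim disjE) (simp_all del: v_carrier u_carrier, simp_all add: algebra_simps)
      qed (use that in auto)
      ultimately show ?thesis unfolding Mw[OF z] Az by simp
    qed
    have "p\<^sup>2 = 1" using pp by (simp add: power2_eq_square)
    then have "Re ((M *\<^sub>v ?z) \<bullet>c ?z) = - 2 * Re (?c + p * ?d)"
      unfolding form[OF z] phase_identity[OF pp(3)] by (simp add: algebra_simps)
    also have "\<dots> = 0" using p cd by auto
    finally have "M *\<^sub>v ?z = 0\<^sub>v n" by (intro psd_form_zero_imp_kernel[OF M herm _ z] psd)
    then have neg: "- (A *\<^sub>v u + p \<cdot>\<^sub>v (mat_adjoint A *\<^sub>v v)) = 0\<^sub>v n" unfolding Mz .
    show ?thesis
      using arg_cong[OF neg, of uminus] by simp
  qed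
  have idx: "(A *\<^sub>v u) $ i = 0 \<and> (mat_adjoint A *\<^sub>v v) $ i = 0" if i: "i < n" for i
  proof -
    have "(A *\<^sub>v u) $ i + p * (mat_adjoint A *\<^sub>v v) $ i = 0" if "p = 1 \<or> p = -1" for p
      using arg_cong[OF sum0[OF that], of "\<lambda>w. w $ i"] i A by (simp del: index_mult_mat_vec)
    from this[of 1] this[of "-1"] show ?thesis by (auto simp: add_eq_0_iff)
  qed
  show "A *\<^sub>v u = 0\<^sub>v n" using idx A by (intro eq_vecI) (auto simp del: index_mult_mat_vec)
  show "mat_adjoint A *\<^sub>v v = 0\<^sub>v n"
    using idx A by (intro eq_vecI) (auto simp del: index_mult_mat_vec)
qed

end

section \<open>Extremal vectors and the disk\<close>

lemma max_singular_vector_exists: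
  assumes "A \<in> carrier_mat n n" "A \<noteq> 0\<^sub>m n n"
  obtains v where "max_singular_vector A n v"
proof -
  obtain v where "v \<in> carrier_vec n" "euclid_norm v = 1" "euclid_norm (A *\<^sub>v v) = op_norm A"
    using op_norm_attained[OF assms(1) op_norm_pos(1)[OF assms]] .
  then have "max_singular_vector A n v"
    using assms by unfold_locales (auto simp: V_max_def)
  then show thesis by (rule that)
qed

context max_singular_vector
begin

text \<open>In other words, \<open>v\<close> and \<open>u\<close> span a subspace that reduces \<open>A\<close>, on which \<open>A\<close> acts as \<open>s J\<close>.\<close>

definition annihilated where
  "annihilated \<longleftrightarrow> A *\<^sub>v u = 0\<^sub>v n \<and> mat_adjoint A *\<^sub>v v = 0\<^sub>v n"

text \<open>Since \<open>s \<langle>u, v\<rangle> = \<langle>A v, v\<rangle> = \<langle>v, A\<^sup>* v\<rangle> = 0\<close>, the vectors \<open>v\<close> and \<open>u\<close> are orthonormal, and only the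
  product of \<open>A (a v) = s a u\<close> with \<open>b u\<close> survives.\<close>

lemma annihilated_form:
  assumes "annihilated"
  shows "(A *\<^sub>v (a \<cdot>\<^sub>v v + b \<cdot>\<^sub>v u)) \<bullet>c (a \<cdot>\<^sub>v v + b \<cdot>\<^sub>v u) = s * (a * cnj b)"
    and "(euclid_norm (a \<cdot>\<^sub>v v + b \<cdot>\<^sub>v u))\<^sup>2 = (cmod a)\<^sup>2 + (cmod b)\<^sup>2"
proof -
  have Au: "A *\<^sub>v u = 0\<^sub>v n" and Av: "mat_adjoint A *\<^sub>v v = 0\<^sub>v n"
    using assms by (auto simp: annihilated_def)
  have "s * (u \<bullet>c v) = (A *\<^sub>v v) \<bullet>c v" unfolding A_v by (simp add: cinner_simps[of _ n])
  also have "\<dots> = 0" unfolding cinner_adjoint[OF A v_carrier v_carrier] Av by simp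
  finally have uv: "u \<bullet>c v = 0" using s_pos by simp
  then have vu: "v \<bullet>c u = 0" using cinner_commute[of u n v] by simp
  have "A *\<^sub>v (a \<cdot>\<^sub>v v + b \<cdot>\<^sub>v u) = a \<cdot>\<^sub>v (complex_of_real s \<cdot>\<^sub>v u)"
    using A by (simp add: mult_add_distrib_mat_vec[of _ n n] mult_mat_vec[of _ n n] A_v Au smult_r_zero_vec)
  then show "(A *\<^sub>v (a \<cdot>\<^sub>v v + b \<cdot>\<^sub>v u)) \<bullet>c (a \<cdot>\<^sub>v v + b \<cdot>\<^sub>v u) = s * (a * cnj b)"
    by (simp add: cinner_simps[of _ n] uv)
  show "(euclid_norm (a \<cdot>\<^sub>v v + b \<cdot>\<^sub>v u))\<^sup>2 = (cmod a)\<^sup>2 + (cmod b)\<^sup>2"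
    using euclid_norm_add_sq[of "a \<cdot>\<^sub>v v" n "b \<cdot>\<^sub>v u"]
    by (simp add: euclid_norm_smult v_unit u_unit cinner_simps[of _ n] vu)
qed

lemma annihilated_extremal_vector:
  assumes ann: "annihilated" and ab: "cmod a = 1" "cmod b = 1"
    and z: "z = complex_of_real (1 / sqrt 2) \<cdot>\<^sub>v (a \<cdot>\<^sub>v v + b \<cdot>\<^sub>v u)"
  shows "z \<in> carrier_vec n" "euclid_norm z = 1" "cmod ((A *\<^sub>v z) \<bullet>c z) = s / 2"
proof -
  define h where "h = complex_of_real (1 / sqrt 2)"
  have hh: "(cmod h)\<^sup>2 = 1 / 2"
    by (simp add: h_def norm_divide power_divide)
  have z': "z = (h * a) \<cdot>\<^sub>v v + (h * b) \<cdot>\<^sub>v u"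
    unfolding z h_def[symmetric] by (simp add: smult_add_distrib_vec[of _ n] smult_smult_assoc)
  show "z \<in> carrier_vec n" unfolding z by simp
  have "(euclid_norm z)\<^sup>2 = 1"
    unfolding z' annihilated_form(2)[OF ann] norm_mult power_mult_distrib hh ab by simp
  then show "euclid_norm z = 1" using euclid_norm_nonneg[of z] by (simp add: power2_eq_1_iff)
  have "cmod ((A *\<^sub>v z) \<bullet>c z) = s * (cmod h)\<^sup>2"
    unfolding z' annihilated_form(1)[OF ann] using s_pos ab
    by (simp add: norm_mult power2_eq_square)
  then show "cmod ((A *\<^sub>v z) \<bullet>c z) = s / 2" unfolding hh by simp
qed

lemma annihilated_if_memberships:
  assumes "v \<in> mat_kernel (mat_adjoint A)" "A *\<^sub>v v \<in> mat_kernel A"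
  shows "annihilated"
proof -
  have "A *\<^sub>v u = complex_of_real (1 / s) \<cdot>\<^sub>v (A *\<^sub>v (A *\<^sub>v v))"
    unfolding normalized_image_def by (rule mult_mat_vec[OF A]) simp
  then show ?thesis
    using mat_kernelD(2)[OF A assms(2)] mat_kernelD(2)[OF mat_adjoint_carrier[OF A] assms(1)]
    by (simp add: annihilated_def)
qed

lemma annihilated_memberships:
  assumes "annihilated"
  shows "v \<in> mat_range (mat_adjoint A) \<inter> mat_kernel (mat_adjoint A)"
    and "A *\<^sub>v v \<in> mat_range A \<inter> mat_kernel A"
proof -
  show "v \<in> mat_range (mat_adjoint A) \<inter> mat_kernel (mat_adjoint A)"
    using assms v_in_range_adjoint mat_kernelI[OF mat_adjoint_carrier[OF A] v_carrier]
    by (simp add: annihilated_def)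
  have "A *\<^sub>v (A *\<^sub>v v) = 0\<^sub>v n"
    using assms mult_mat_vec[OF A u_carrier] unfolding A_v by (simp add: annihilated_def)
  then show "A *\<^sub>v v \<in> mat_range A \<inter> mat_kernel A"
    using mat_kernelI[OF A images_carrier(1)[OF v_carrier]] A v_carrier
    by (auto simp: mat_range_def simp del: v_carrier)
qed

lemma extremal_imp_maximizer:
  assumes eq: "s = 2 * num_radius A" and ann: "annihilated"
  shows "maximizes_num_radius A (complex_of_real (1 / sqrt 2) \<cdot>\<^sub>v (v + u))"
  using annihilated_extremal_vector[OF ann, of 1 1, OF _ _ refl] num_radius_upper[OF A n_pos] A eq
  by (auto simp: maximizes_num_radius_def)

lemma maximizer_imp_extremal:
  assumes ann: "annihilated"
    and max: "maximizes_num_radius A (complex_of_real (1 / sqrt 2) \<cdot>\<^sub>v (v + u))"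
  shows "s = 2 * num_radius A"
proof -
  have "cmod ((A *\<^sub>v w) \<bullet>c w) \<le> s / 2" if "w \<in> carrier_vec n" "euclid_norm w = 1" for w
    using max annihilated_extremal_vector(3)[OF ann, of 1 1, OF _ _ refl] that A
    by (auto simp: maximizes_num_radius_def)
  then have "num_radius A \<le> s / 2" by (rule num_radius_least[OF A n_pos])
  then show ?thesis using op_norm_le_twice_num_radius by simp
qed

lemma extremal_imp_in_Theta:
  assumes eq: "s = 2 * num_radius A" and ann: "annihilated" and ab: "cmod a = 1" "cmod b = 1"
  shows "complex_of_real (1 / sqrt 2) \<cdot>\<^sub>v (a \<cdot>\<^sub>v v + b \<cdot>\<^sub>v u) \<in> Theta A"
proof -
  let ?h = "complex_of_real (1 / sqrt 2)"
  let ?z = "?h \<cdot>\<^sub>v (a \<cdot>\<^sub>v v + b \<cdot>\<^sub>v u)"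
  let ?x = "(?h * a) \<cdot>\<^sub>v v" and ?y = "(?h * b) \<cdot>\<^sub>v u"
  obtain w where w: "w \<in> carrier_vec n" "v = mat_adjoint A *\<^sub>v w"
    using v_in_range_adjoint A by (auto simp: mat_range_def)
  have "?x = mat_adjoint A *\<^sub>v ((?h * a) \<cdot>\<^sub>v w)"
    using mult_mat_vec[OF mat_adjoint_carrier[OF A] w(1)] w(2) by simp
  then have x: "?x \<in> mat_range (mat_adjoint A)" unfolding mat_range_def using A w(1) by auto
  have "A *\<^sub>v ?y = 0\<^sub>v n"
    using ann mult_mat_vec[OF A u_carrier] by (simp add: annihilated_def)
  then have y: "?y \<in> mat_kernel A" by (intro mat_kernelI[OF A]) auto
  have "?x + 0 \<cdot>\<^sub>v u = ?x" by (rule add_zero_smult_vec[of _ n]) auto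
  then have "(A *\<^sub>v ?x) \<bullet>c ?x = 0"
    using annihilated_form(1)[OF ann, of "?h * a" 0] by simp
  moreover have "?z = ?x + ?y" by (simp add: smult_add_distrib_vec[of _ n] smult_smult_assoc)
  ultimately show ?thesis
    unfolding Theta_def using x y A eq annihilated_extremal_vector[OF ann ab refl] by auto
qed

text \<open>The vectors \<open>cos t e\<^sup>i\<^sup>\<theta> v + sin t u\<close> have the numerical range values
  \<open>(s / 2) sin (2 t) e\<^sup>i\<^sup>\<theta>\<close>, which sweep out the disk.\<close>

lemma extremal_imp_disk:
  assumes eq: "s = 2 * num_radius A" and ann: "annihilated"
  shows "field_of_values A = cball 0 (1 / 2 * s)"
proof (rule equalityI; rule subsetI)
  fix c assume "c \<in> field_of_values A"
  then show "c \<in> cball 0 (1 / 2 * s)"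
    using num_radius_upper[OF A n_pos] eq A by (auto simp: field_of_values_def)
next
  fix c :: complex assume "c \<in> cball 0 (1 / 2 * s)"
  then have c: "cmod c \<le> s / 2" by simp
  \<comment> \<open>Chosen such that \<open>(s / 2) sin (2 t) = |c|\<close>.\<close>
  define t where "t = arcsin (2 * cmod c / s) / 2"
  have "2 * cmod c / s \<le> 1" using c s_pos by (simp add: field_simps)
  moreover have "0 \<le> 2 * cmod c / s" using s_pos by simp
  ultimately have "sin (arcsin (2 * cmod c / s)) = 2 * cmod c / s"
    by (intro sin_arcsin) linarith+
  then have "sin (2 * t) = 2 * cmod c / s" by (simp add: t_def)
  then have t: "s * (cos t * sin t) = cmod c"
    using s_pos unfolding sin_double by (simp add: field_simps)
  let ?a = "complex_of_real (cos t) * cis (Arg c)" and ?b = "complex_of_real (sin t)"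
  let ?z = "?a \<cdot>\<^sub>v v + ?b \<cdot>\<^sub>v u"
  have "(euclid_norm ?z)\<^sup>2 = 1"
    unfolding annihilated_form(2)[OF ann] by (simp add: norm_mult)
  then have z: "euclid_norm ?z = 1" using euclid_norm_nonneg[of ?z] by (simp add: power2_eq_1_iff)
  have "(A *\<^sub>v ?z) \<bullet>c ?z = complex_of_real (s * (cos t * sin t)) * cis (Arg c)"
    unfolding annihilated_form(1)[OF ann] by simp
  also have "\<dots> = c" unfolding t using rcis_cmod_Arg[of c] by (simp add: rcis_def)
  finally show "c \<in> field_of_values A"
    unfolding field_of_values_def using z A by (auto intro!: exI[of _ ?z])
qed

end

text \<open>For \<open>z = x + y\<close> in \<open>\<Theta>\<close>, only \<open>p = \<langle>A x, y\<rangle>\<close> contributes to \<open>\<langle>A z, z\<rangle>\<close>, and \<open>x\<close> is orthogonal to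
  \<open>y\<close>. Let \<open>e\<close> be the phase of \<open>p\<close>. Expanding \<open>0 \<le> \<parallel>A x - s e y\<parallel>\<^sup>2\<close> gives
  \<open>2 s |p| \<le> \<parallel>A x\<parallel>\<^sup>2 + s\<^sup>2 \<parallel>y\<parallel>\<^sup>2 \<le> s\<^sup>2 (\<parallel>x\<parallel>\<^sup>2 + \<parallel>y\<parallel>\<^sup>2) = s\<^sup>2\<close>, that is \<open>2 r(A) \<le> s\<close>. As the opposite
  inequality always holds, equality prevails throughout: \<open>A x = s e y\<close> and \<open>x\<close> is stretched
  maximally. So \<open>x\<close> and \<open>y\<close> have equal norms, and \<open>v = \<surd>2 x\<close> exhibits \<open>z\<close> as an element of \<open>\<Omega>\<close>.\<close>

lemma Theta_imp_extremal:
  assumes A: "A \<in> carrier_mat n n" and nz: "A \<noteq> 0\<^sub>m n n" and "z \<in> Theta A"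
  shows "op_norm A = 2 * num_radius A" and "z \<in> Omega A"
proof -
  let ?s = "op_norm A" and ?r = "num_radius A"
  note n = op_norm_pos(1)[OF A nz] and s = op_norm_pos(2)[OF A nz]
  obtain x y where unit: "euclid_norm z = 1" and r: "?r = cmod ((A *\<^sub>v z) \<bullet>c z)"
    and x: "x \<in> mat_range (mat_adjoint A)" and y: "y \<in> mat_kernel A"
    and z: "z = x + y" and xx: "(A *\<^sub>v x) \<bullet>c x = 0"
    using \<open>z \<in> Theta A\<close> by (auto simp: Theta_def)
  obtain w where w: "w \<in> carrier_vec n" "x = mat_adjoint A *\<^sub>v w"
    using x A by (auto simp: mat_range_def)
  have xc: "x \<in> carrier_vec n" using w A by simp
  note yc = mat_kernelD(1)[OF A y] and Ay = mat_kernelD(2)[OF A y]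
  have Ax: "A *\<^sub>v x \<in> carrier_vec n" using A xc by simp
  have "x \<bullet>c y = 0" unfolding w(2) cinner_adjoint'[OF A yc w(1), symmetric] Ay using w(1) by simp
  then have xy: "(euclid_norm x)\<^sup>2 + (euclid_norm y)\<^sup>2 = 1"
    using euclid_norm_add_sq[OF xc yc] unit z by simp
  \<comment> \<open>The value \<open>p\<close> is the whole of \<open>\<langle>A z, z\<rangle>\<close>, because \<open>A y = 0\<close> and \<open>\<langle>A x, x\<rangle> = 0\<close>.\<close>
  define p where "p = (A *\<^sub>v x) \<bullet>c y"
  have "A *\<^sub>v z = A *\<^sub>v x" unfolding z mult_add_distrib_mat_vec[OF A xc yc] Ay using Ax by simp
  then have rp: "?r = cmod p"
    unfolding r p_def using xx xc yc Ax by (simp add: z cinner_add_right[of _ n])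
  define e where "e = cis (Arg p)"
  have e: "cnj e * p = cmod p" "cmod e = 1" "e * cnj e = 1"
  proof -
    show ee: "e * cnj e = 1" by (simp add: e_def cis_cnj cis_mult)
    have "p = cmod p * e" using rcis_cmod_Arg[of p] by (simp add: rcis_def e_def)
    then have "cnj e * p = cmod p * (e * cnj e)" by (metis mult.assoc mult.commute)
    then show "cnj e * p = cmod p" by (simp add: ee)
    show "cmod e = 1" by (simp add: e_def)
  qed
  let ?g = "A *\<^sub>v x + (- complex_of_real ?s * e) \<cdot>\<^sub>v y"
  have "(A *\<^sub>v x) \<bullet>c ((- complex_of_real ?s * e) \<cdot>\<^sub>v y) = - complex_of_real ?s * (cnj e * p)"
    using Ax yc by (simp add: cinner_smult_right[of _ n] p_def)
  also have "\<dots> = complex_of_real (- ?s * cmod p)" unfolding e by simp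
  finally have "Re ((A *\<^sub>v x) \<bullet>c ((- complex_of_real ?s * e) \<cdot>\<^sub>v y)) = - ?s * cmod p"
    by simp
  then have g: "(euclid_norm ?g)\<^sup>2 = (euclid_norm (A *\<^sub>v x))\<^sup>2 + (?s * euclid_norm y)\<^sup>2 - 2 * ?s * ?r"
    using euclid_norm_add_sq[OF Ax, of "(- complex_of_real ?s * e) \<cdot>\<^sub>v y"] yc s
    by (simp add: euclid_norm_smult norm_mult e rp)
  have le: "(euclid_norm (A *\<^sub>v x))\<^sup>2 \<le> (?s * euclid_norm x)\<^sup>2"
    using op_norm_bound[OF A n xc] by (simp add: power_mono)
  have tot: "(?s * euclid_norm x)\<^sup>2 + (?s * euclid_norm y)\<^sup>2 = ?s * ?s"
  proof -
    have "(?s * euclid_norm x)\<^sup>2 + (?s * euclid_norm y)\<^sup>2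
        = ?s * ?s * ((euclid_norm x)\<^sup>2 + (euclid_norm y)\<^sup>2)"
      by (simp add: power2_eq_square algebra_simps)
    then show ?thesis unfolding xy by simp
  qed
  have "0 \<le> (euclid_norm ?g)\<^sup>2" by simp
  then have "2 * ?s * ?r \<le> ?s * ?s" using g le tot by linarith
  then have "2 * ?r \<le> ?s" using s by (simp add: mult.commute)
  moreover obtain v0 where "max_singular_vector A n v0"
    using max_singular_vector_exists[OF A nz] .
  then have "?s \<le> 2 * ?r" by (rule max_singular_vector.op_norm_le_twice_num_radius)
  ultimately show eq: "?s = 2 * ?r" by simp
  then have "2 * ?s * ?r = ?s * ?s" by simp
  moreover have "0 \<le> (euclid_norm ?g)\<^sup>2" by simp
  ultimately have g0: "(euclid_norm ?g)\<^sup>2 = 0" and Ax2: "(euclid_norm (A *\<^sub>v x))\<^sup>2 = (?s * euclid_norm x)\<^sup>2"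
    using g le tot by linarith+
  have gc: "?g \<in> carrier_vec n" using Ax yc by simp
  have "?g = 0\<^sub>v n" using g0 euclid_norm_eq_0_iff[OF gc] by simp
  then have Axy: "A *\<^sub>v x = (complex_of_real ?s * e) \<cdot>\<^sub>v y"
  proof (intro eq_vecI)
    fix i assume "i < dim_vec ((complex_of_real ?s * e) \<cdot>\<^sub>v y)"
    then have i: "i < n" using yc by simp
    have "?g $ i = 0" using \<open>?g = 0\<^sub>v n\<close> i by simp
    then show "(A *\<^sub>v x) $ i = ((complex_of_real ?s * e) \<cdot>\<^sub>v y) $ i"
      using i A yc by (simp del: index_mult_mat_vec)
  qed (use A yc in auto)
  have xV: "euclid_norm (A *\<^sub>v x) = ?s * euclid_norm x"
    using Ax2 s by (simp add: power2_eq_iff_nonneg)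
  then have "euclid_norm y = euclid_norm x"
    using s e unfolding Axy by (simp add: euclid_norm_smult norm_mult)
  then have "(euclid_norm x)\<^sup>2 = 1 / 2" using xy by simp
  then have nx: "sqrt 2 * euclid_norm x = 1"
    by (metis real_sqrt_divide real_sqrt_one real_sqrt_abs abs_of_nonneg euclid_norm_nonneg
        nonzero_mult_div_cancel_left times_divide_eq_right real_sqrt_eq_zero_cancel_iff
        zero_neq_numeral)
  let ?q = "complex_of_real (sqrt 2)"
  define v where "v = ?q \<cdot>\<^sub>v x"
  have vc: "v \<in> carrier_vec n" using xc by (simp add: v_def)
  have Av: "A *\<^sub>v v = ?q \<cdot>\<^sub>v (A *\<^sub>v x)" unfolding v_def by (rule mult_mat_vec[OF A xc])
  have v1: "euclid_norm v = 1" using nx by (simp add: v_def euclid_norm_smult)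
  have "euclid_norm (A *\<^sub>v v) = ?s * euclid_norm v"
    unfolding Av unfolding v_def euclid_norm_smult xV by simp
  then have "v \<in> V_max A"
    using vc A by (simp add: V_max_def)
  moreover have "z = complex_of_real (1 / sqrt 2) \<cdot>\<^sub>v (exp (\<i> * complex_of_real 0) \<cdot>\<^sub>v v
      + exp (\<i> * complex_of_real (- Arg p)) \<cdot>\<^sub>v normalized_image A v)"
  proof -
    have ex: "exp (\<i> * complex_of_real (- Arg p)) = cnj e"
      by (simp only: cis_conv_exp[symmetric] e_def cis_cnj)
    have img: "normalized_image A v = (?q * e) \<cdot>\<^sub>v y"
      using s by (simp add: normalized_image_def Av Axy smult_smult_assoc)
    have "cnj e * (?q * e) = ?q * (e * cnj e)" by (simp only: ac_simps)
    then have coeff: "cnj e * (?q * e) = ?q" unfolding e(3) by simp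
    have u: "cnj e \<cdot>\<^sub>v normalized_image A v = ?q \<cdot>\<^sub>v y"
      by (simp only: img smult_smult_assoc coeff)
    show ?thesis
      unfolding ex u using xc yc
      by (simp add: z v_def smult_add_distrib_vec[of _ n] smult_smult_assoc flip: of_real_mult)
  qed
  ultimately show "z \<in> Omega A" using v1 unfolding Omega_def by blast
qed

section \<open>Orthonormal families and isometries\<close>

text \<open>Padding with zero rows turns \<open>M\<close> into a singular square matrix with the same kernel.\<close>

lemma wide_matrix_kernel:
  assumes M: "M \<in> carrier_mat p q" and pq: "p < q"
  obtains x :: "complex vec" where "x \<in> carrier_vec q" "x \<noteq> 0\<^sub>v q" "M *\<^sub>v x = 0\<^sub>v p"
proof -
  define P where "P = mat q q (\<lambda>(i, j). if i < p then M $$ (i, j) else 0)"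
  have P: "P \<in> carrier_mat q q" by (simp add: P_def)
  have "P\<^sup>T *\<^sub>v unit_vec q p = 0\<^sub>v q"
    using pq by (intro eq_vecI) (auto simp: P_def)
  moreover have "(unit_vec q p :: complex vec) \<noteq> 0\<^sub>v q" using pq by simp
  moreover have "P\<^sup>T \<in> carrier_mat q q" "(unit_vec q p :: complex vec) \<in> carrier_vec q" using P by auto
  ultimately have "det P\<^sup>T = 0" using det_0_iff_vec_prod_zero_field by blast
  then have "det P = 0" using det_transpose[OF P] by simp
  then obtain x where x: "x \<in> carrier_vec q" "x \<noteq> 0\<^sub>v q" "P *\<^sub>v x = 0\<^sub>v q"
    using det_0_iff_vec_prod_zero_field[OF P] by blast
  have "M *\<^sub>v x = 0\<^sub>v p"
  proof (rule eq_vecI)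
    fix i assume "i < dim_vec (0\<^sub>v p :: complex vec)"
    then have i: "i < p" by simp
    have "row M i = row P i" using i pq M by (intro eq_vecI) (auto simp: P_def)
    then have "(M *\<^sub>v x) $ i = (P *\<^sub>v x) $ i" using i pq M P by simp
    also have "\<dots> = 0" unfolding x(3) using i pq by simp
    finally show "(M *\<^sub>v x) $ i = 0\<^sub>v p $ i" using i by simp
  qed (use M in simp)
  then show thesis using x that by blast
qed

text \<open>A family of length \<open>k\<close> is given by the first \<open>k\<close> values of a function on the natural numbers, so
  that appending and interleaving families are plain function definitions.\<close>

definition orthonormal :: "nat \<Rightarrow> nat \<Rightarrow> (nat \<Rightarrow> complex vec) \<Rightarrow> bool" where
  "orthonormal n k q \<longleftrightarrow> (\<forall>i<k. q i \<in> carrier_vec n) \<and>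
     (\<forall>i<k. \<forall>j<k. q i \<bullet>c q j = (if i = j then 1 else 0))"

definition cols_mat :: "nat \<Rightarrow> nat \<Rightarrow> (nat \<Rightarrow> complex vec) \<Rightarrow> complex mat" where
  "cols_mat n k q = mat n k (\<lambda>(i, j). q j $ i)"

lemma cols_mat_carrier [simp]: "cols_mat n k q \<in> carrier_mat n k"
  by (simp add: cols_mat_def)

lemma cols_mat_dims [simp]: "dim_row (cols_mat n k q) = n" "dim_col (cols_mat n k q) = k"
  by (simp_all add: cols_mat_def)

lemma col_cols_mat: "j < k \<Longrightarrow> q j \<in> carrier_vec n \<Longrightarrow> col (cols_mat n k q) j = q j"
  by (intro eq_vecI) (auto simp: cols_mat_def)

lemma adjoint_mult_vec_index:
  fixes V :: "complex mat"
  assumes "V \<in> carrier_mat n k" "x \<in> carrier_vec n" "i < k"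
  shows "(mat_adjoint V *\<^sub>v x) $ i = x \<bullet>c col V i"
  using assms
  by (auto simp: scalar_prod_def mat_adjoint_index intro!: sum.cong)

lemma adjoint_conjugation_index:
  fixes Q :: "complex mat"
  assumes Q: "Q \<in> carrier_mat n k" and A: "A \<in> carrier_mat n n" and ij: "i < k" "j < k"
  shows "(mat_adjoint Q * A * Q) $$ (i, j) = (A *\<^sub>v col Q j) \<bullet>c col Q i"
proof -
  have "mat_adjoint Q * A * Q = mat_adjoint Q * (A * Q)"
    using Q A by (intro assoc_mult_mat) auto
  then have "(mat_adjoint Q * A * Q) $$ (i, j) = (mat_adjoint Q *\<^sub>v col (A * Q) j) $ i"
    using Q A ij by simp
  also have "col (A * Q) j = A *\<^sub>v col Q j" using Q A ij by (intro eq_vecI) auto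
  also have "(mat_adjoint Q *\<^sub>v (A *\<^sub>v col Q j)) $ i = (A *\<^sub>v col Q j) \<bullet>c col Q i"
    using Q A ij by (intro adjoint_mult_vec_index[of _ n k]) auto
  finally show ?thesis .
qed

lemma orthonormal_isometry:
  assumes "orthonormal n k q"
  shows "mat_adjoint (cols_mat n k q) * cols_mat n k q = 1\<^sub>m k"
proof (rule eq_matI)
  fix i j assume ij: "i < dim_row (1\<^sub>m k :: complex mat)" "j < dim_col (1\<^sub>m k :: complex mat)"
  let ?Q = "cols_mat n k q"
  have "(mat_adjoint ?Q * 1\<^sub>m n * ?Q) $$ (i, j) = (1\<^sub>m n *\<^sub>v col ?Q j) \<bullet>c col ?Q i"
    using ij by (intro adjoint_conjugation_index[of _ n k]) auto
  also have "\<dots> = q j \<bullet>c q i"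
    using assms ij by (simp add: col_cols_mat orthonormal_def)
  also have "\<dots> = 1\<^sub>m k $$ (i, j)" using assms ij by (simp add: orthonormal_def)
  also have "mat_adjoint ?Q * 1\<^sub>m n = mat_adjoint ?Q"
    by (rule right_mult_one_mat[OF mat_adjoint_carrier[OF cols_mat_carrier]])
  finally show "(mat_adjoint ?Q * ?Q) $$ (i, j) = 1\<^sub>m k $$ (i, j)" .
qed auto

lemma isometry_left_inverse:
  fixes V :: "complex mat"
  assumes V: "V \<in> carrier_mat n k" and iso: "mat_adjoint V * V = 1\<^sub>m k" and y: "y \<in> carrier_vec k"
  shows "mat_adjoint V *\<^sub>v (V *\<^sub>v y) = y"
proof -
  have "mat_adjoint V *\<^sub>v (V *\<^sub>v y) = (mat_adjoint V * V) *\<^sub>v y"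
    using assoc_mult_mat_vec[OF mat_adjoint_carrier[OF V] V y] by simp
  then show ?thesis using y by (simp add: iso)
qed

lemma isometry_norm:
  fixes V :: "complex mat"
  assumes V: "V \<in> carrier_mat n k" and iso: "mat_adjoint V * V = 1\<^sub>m k" and y: "y \<in> carrier_vec k"
  shows "euclid_norm (V *\<^sub>v y) = euclid_norm y"
  unfolding euclid_norm_def
  using cinner_adjoint[OF V y, of "V *\<^sub>v y"] V y isometry_left_inverse[OF V iso y] by simp

text \<open>\<open>V V\<^sup>*\<close> is an orthogonal projection; the claim is the nonnegativity of the squared norm of
  \<open>x - V V\<^sup>* x\<close>.\<close>

lemma isometry_adjoint_contraction:
  fixes V :: "complex mat"
  assumes V: "V \<in> carrier_mat n k" and iso: "mat_adjoint V * V = 1\<^sub>m k" and x: "x \<in> carrier_vec n"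
  shows "euclid_norm (mat_adjoint V *\<^sub>v x) \<le> euclid_norm x"
proof -
  let ?y = "mat_adjoint V *\<^sub>v x"
  have y: "?y \<in> carrier_vec k" and Vy: "V *\<^sub>v ?y \<in> carrier_vec n" using V x by auto
  have my: "(-1) \<cdot>\<^sub>v (V *\<^sub>v ?y) \<in> carrier_vec n" using Vy by simp
  have "x \<bullet>c (V *\<^sub>v ?y) = ?y \<bullet>c ?y" by (rule cinner_adjoint'[OF V y x])
  then have "(euclid_norm (x + (-1) \<cdot>\<^sub>v (V *\<^sub>v ?y)))\<^sup>2 = (euclid_norm x)\<^sup>2 - (euclid_norm ?y)\<^sup>2"
    unfolding euclid_norm_add_sq[OF x my] cinner_smult_right[OF Vy x] euclid_norm_smult
      isometry_norm[OF V iso y]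
    by (simp add: cinner_self)
  then have "(euclid_norm ?y)\<^sup>2 \<le> (euclid_norm x)\<^sup>2"
    using zero_le_power2[of "euclid_norm (x + (-1) \<cdot>\<^sub>v (V *\<^sub>v ?y))"] by linarith
  then show ?thesis by (rule power2_le_imp_le) simp
qed

lemma orthonormal_le_dim:
  assumes "orthonormal n k q"
  shows "k \<le> n"
proof (rule ccontr)
  let ?Q = "cols_mat n k q"
  assume "\<not> k \<le> n"
  then obtain x where x: "x \<in> carrier_vec k" "x \<noteq> 0\<^sub>v k" "?Q *\<^sub>v x = 0\<^sub>v n"
    using wide_matrix_kernel[OF cols_mat_carrier] by (metis not_le)
  have "euclid_norm x = 0"
    using isometry_norm[OF cols_mat_carrier orthonormal_isometry[OF assms] x(1)] x(3) by simp
  then show False using x euclid_norm_eq_0_iff by blast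
qed

lemma orthonormal_append:
  assumes q: "orthonormal n k q" and r: "orthonormal n l r"
    and qr: "\<And>i j. i < k \<Longrightarrow> j < l \<Longrightarrow> r j \<bullet>c q i = 0"
  shows "orthonormal n (k + l) (\<lambda>i. if i < k then q i else r (i - k))"
proof -
  have "q i \<bullet>c r j = 0" if "i < k" "j < l" for i j
    using qr[OF that] cinner_commute[of "r j" n "q i"] q r that by (simp add: orthonormal_def)
  moreover have "i - k < l" if "i < k + l" "\<not> i < k" for i using that by simp
  ultimately show ?thesis using q r qr unfolding orthonormal_def
    by auto
qed

text \<open>Orthonormal families in the kernel have at most \<open>n\<close> members, so there is a longest one. A nonzero
  kernel vector orthogonal to all its members could be normalized and appended.\<close>

lemma maximal_orthonormal_in_kernel:
  assumes M: "M \<in> carrier_mat p n"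
  obtains k q where "orthonormal n k q" "\<And>i. i < k \<Longrightarrow> q i \<in> mat_kernel M"
    "\<And>x. x \<in> mat_kernel M \<Longrightarrow> (\<And>i. i < k \<Longrightarrow> x \<bullet>c q i = 0) \<Longrightarrow> x = 0\<^sub>v n"
proof -
  define P where "P k \<longleftrightarrow> (\<exists>q. orthonormal n k q \<and> (\<forall>i<k. q i \<in> mat_kernel M))" for k
  have "P 0" by (auto simp: P_def orthonormal_def)
  moreover have bound: "\<And>k. P k \<Longrightarrow> k \<le> n" using orthonormal_le_dim by (auto simp: P_def)
  ultimately have "P (Greatest P)" by (rule GreatestI_nat)
  then obtain q where q: "orthonormal n (Greatest P) q" "\<forall>i<Greatest P. q i \<in> mat_kernel M"
    by (auto simp: P_def)
  show thesis
  proof (rule that[OF q(1)])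
    fix x assume x: "x \<in> mat_kernel M" and orth: "\<And>i. i < Greatest P \<Longrightarrow> x \<bullet>c q i = 0"
    show "x = 0\<^sub>v n"
    proof (rule ccontr)
      assume nz: "x \<noteq> 0\<^sub>v n"
      note xc = mat_kernelD(1)[OF M x]
      obtain y where y: "y \<in> carrier_vec n" "euclid_norm y = 1"
        and xy: "x = complex_of_real (euclid_norm x) \<cdot>\<^sub>v y"
        using normalize_vec[OF xc nz] .
      have pos: "euclid_norm x \<noteq> 0" using xc nz by (simp add: euclid_norm_eq_0_iff)
      then have yx: "y = complex_of_real (1 / euclid_norm x) \<cdot>\<^sub>v x"
        by (subst xy) (simp add: smult_smult_assoc)
      have yk: "y \<in> mat_kernel M" unfolding yx by (rule mat_kernel_smult[OF M x])
      have "orthonormal n 1 (\<lambda>_. y)" using y by (simp add: orthonormal_def cinner_self)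
      then have "orthonormal n (Greatest P + 1) (\<lambda>i. if i < Greatest P then q i else y)"
      proof (rule orthonormal_append[OF q(1)])
        fix i j :: nat assume "i < Greatest P"
        then show "y \<bullet>c q i = 0" unfolding yx
          using orth q(1) xc by (simp add: cinner_smult_left[of _ n] orthonormal_def)
      qed
      then have "P (Greatest P + 1)" using q(2) yk unfolding P_def by (intro exI conjI) auto
      then have "Greatest P + 1 \<le> Greatest P" using bound by (intro Greatest_le_nat) auto
      then show False by simp
    qed
  qed (use q in auto)
qed

text \<open>The complement is a maximal orthonormal family in the kernel of \<open>E\<^sup>*\<close>, where \<open>E\<close> has the columns
  \<open>e\<close>. If both families together had fewer than \<open>n\<close> members, \<open>wide_matrix_kernel\<close> would supply a
  nonzero vector orthogonal to all of them, against maximality.\<close>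

lemma orthonormal_completion:
  assumes e: "orthonormal n k e"
  obtains w where "orthonormal n (n - k) w" "\<And>i j. i < k \<Longrightarrow> j < n - k \<Longrightarrow> w j \<bullet>c e i = 0"
proof -
  define M where "M = mat_adjoint (cols_mat n k e)"
  have M: "M \<in> carrier_mat k n" unfolding M_def by (intro mat_adjoint_carrier cols_mat_carrier)
  have ker: "x \<in> mat_kernel M \<longleftrightarrow> x \<in> carrier_vec n \<and> (\<forall>i<k. x \<bullet>c e i = 0)" for x
  proof -
    have idx: "(M *\<^sub>v x) $ i = x \<bullet>c e i" if "x \<in> carrier_vec n" "i < k" for i
      unfolding M_def adjoint_mult_vec_index[OF cols_mat_carrier that]
      using that e by (simp add: col_cols_mat orthonormal_def)
    have "M *\<^sub>v x = 0\<^sub>v k \<longleftrightarrow> (\<forall>i<k. (M *\<^sub>v x) $ i = 0)"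
      using M by (auto simp: vec_eq_iff simp del: index_mult_mat_vec)
    then show ?thesis using idx unfolding mat_kernel[OF M] by auto
  qed
  obtain l w where w: "orthonormal n l w" "\<And>i. i < l \<Longrightarrow> w i \<in> mat_kernel M"
    and max: "\<And>x. x \<in> mat_kernel M \<Longrightarrow> (\<And>i. i < l \<Longrightarrow> x \<bullet>c w i = 0) \<Longrightarrow> x = 0\<^sub>v n"
    using maximal_orthonormal_in_kernel[OF M] by blast
  have we: "w j \<bullet>c e i = 0" if "i < k" "j < l" for i j using w(2) that ker by auto
  define q where "q i = (if i < k then e i else w (i - k))" for i
  have q: "orthonormal n (k + l) q" unfolding q_def by (rule orthonormal_append[OF e w(1) we])
  have "\<not> k + l < n"
  proof
    assume "k + l < n"
    then obtain x where x: "x \<in> carrier_vec n" "x \<noteq> 0\<^sub>v n"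
      and Qx: "mat_adjoint (cols_mat n (k + l) q) *\<^sub>v x = 0\<^sub>v (k + l)"
      using wide_matrix_kernel[OF mat_adjoint_carrier[OF cols_mat_carrier]] by metis
    have xq: "x \<bullet>c q i = 0" if "i < k + l" for i
    proof -
      have "x \<bullet>c q i = (mat_adjoint (cols_mat n (k + l) q) *\<^sub>v x) $ i"
        unfolding adjoint_mult_vec_index[OF cols_mat_carrier x(1) that]
        using that q by (simp add: col_cols_mat orthonormal_def)
      then show ?thesis unfolding Qx using that by simp
    qed
    have "x \<bullet>c e i = 0" if "i < k" for i using xq[of i] that by (simp add: q_def)
    then have "x \<in> mat_kernel M" using x ker by blast
    moreover have "x \<bullet>c w i = 0" if "i < l" for i using xq[of "k + i"] that by (simp add: q_def)
    ultimately show False using max x(2) by blast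
  qed
  then have "l = n - k" using orthonormal_le_dim[OF q] by simp
  then show thesis using w(1) we that by blast
qed

text \<open>The isometry \<open>V\<close> with columns \<open>q\<close> maps \<open>\<complex>\<^sup>k\<close> bijectively onto the kernel: for \<open>x\<close> in the kernel,
  \<open>x - V V\<^sup>* x\<close> is a kernel vector orthogonal to every \<open>q i\<close>, hence zero by maximality.\<close>

lemma kernel_dim_eq_orthonormal_card:
  assumes M: "M \<in> carrier_mat p n" and q: "orthonormal n k q"
    and ker: "\<And>i. i < k \<Longrightarrow> q i \<in> mat_kernel M"
    and max: "\<And>x. x \<in> mat_kernel M \<Longrightarrow> (\<And>i. i < k \<Longrightarrow> x \<bullet>c q i = 0) \<Longrightarrow> x = 0\<^sub>v n"
  shows "vectorspace.dim class_ring ((module_vec TYPE(complex) n)\<lparr>carrier := mat_kernel M\<rparr>) = k"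
proof -
  interpret K: kernel p n M by unfold_locales (rule M)
  interpret D: vec_space "TYPE(complex)" k .
  let ?V = "cols_mat n k q"
  let ?W = "(module_vec TYPE(complex) n)\<lparr>carrier := mat_kernel M\<rparr>"
  have V: "?V \<in> carrier_mat n k" by simp
  note iso = orthonormal_isometry[OF q]
  have MV: "M * ?V = 0\<^sub>m p k"
  proof (rule eq_matI)
    fix i j assume ij: "i < dim_row (0\<^sub>m p k :: complex mat)" "j < dim_col (0\<^sub>m p k :: complex mat)"
    have "M *\<^sub>v q j = 0\<^sub>v p" using mat_kernelD(2)[OF M ker] ij by simp
    then have "(M *\<^sub>v q j) $ i = 0" using ij by simp
    then show "(M * ?V) $$ (i, j) = 0\<^sub>m p k $$ (i, j)"
      using ij M q by (simp add: col_cols_mat orthonormal_def)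
  qed (use M in auto)
  have into: "?V *\<^sub>v y \<in> mat_kernel M" if y: "y \<in> carrier_vec k" for y
  proof (rule mat_kernelI[OF M])
    show "?V *\<^sub>v y \<in> carrier_vec n" by (rule mult_mat_vec_carrier[OF V y])
    have "M *\<^sub>v (?V *\<^sub>v y) = (M * ?V) *\<^sub>v y" using assoc_mult_mat_vec[OF M V y] by simp
    then show "M *\<^sub>v (?V *\<^sub>v y) = 0\<^sub>v p"
      using y unfolding MV by (intro eq_vecI) auto
  qed
  have onto: "x \<in> (\<lambda>y. ?V *\<^sub>v y) ` carrier_vec k" if x: "x \<in> mat_kernel M" for x
  proof -
    note xc = mat_kernelD(1)[OF M x]
    let ?y = "mat_adjoint ?V *\<^sub>v x"
    let ?d = "x - ?V *\<^sub>v ?y"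
    have y: "?y \<in> carrier_vec k" by (rule mat_adjoint_mult_vec_carrier[OF V])
    have Vy: "?V *\<^sub>v ?y \<in> carrier_vec n" by (rule mult_mat_vec_carrier[OF V y])
    have d: "?d \<in> carrier_vec n" using Vy xc by simp
    have "M *\<^sub>v ?d = 0\<^sub>v p"
      unfolding mult_minus_distrib_mat_vec[OF M xc Vy] mat_kernelD(2)[OF M x]
        mat_kernelD(2)[OF M into[OF y]] by simp
    then have "?d \<in> mat_kernel M" by (intro mat_kernelI[OF M d])
    moreover have "?d \<bullet>c q i = 0" if i: "i < k" for i
    proof -
      have "mat_adjoint ?V *\<^sub>v ?d = ?y - ?y"
        using mult_minus_distrib_mat_vec[OF mat_adjoint_carrier[OF V] xc Vy]
          isometry_left_inverse[OF V iso y] by simp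
      then have "mat_adjoint ?V *\<^sub>v ?d = 0\<^sub>v k" using y by simp
      moreover have "?d \<bullet>c q i = (mat_adjoint ?V *\<^sub>v ?d) $ i"
        unfolding adjoint_mult_vec_index[OF V d i] using i q by (simp add: col_cols_mat orthonormal_def)
      ultimately show ?thesis using i by simp
    qed
    ultimately have d0: "?d = 0\<^sub>v n" by (rule max)
    have "x = ?V *\<^sub>v ?y"
    proof (rule eq_vecI)
      fix i assume "i < dim_vec (?V *\<^sub>v ?y)"
      then have i: "i < n" by simp
      have "?d $ i = 0" using d0 i by simp
      then show "x $ i = (?V *\<^sub>v ?y) $ i" using i xc by (simp del: index_mult_mat_vec)
    qed (use xc in auto)
    then show ?thesis using y by (rule image_eqI)
  qed
  have hom: "linear_map class_ring (module_vec TYPE(complex) k) ?W (\<lambda>y. ?V *\<^sub>v y)"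
  proof (unfold linear_map_def mod_hom_def mod_hom_axioms_def, intro conjI)
    show "(\<lambda>y. ?V *\<^sub>v y) \<in> module_hom class_ring (module_vec TYPE(complex) k) ?W"
      using into mult_add_distrib_mat_vec[OF V] mult_mat_vec[OF V]
      by (auto simp: module_hom_def module_vec_simps)
  qed (use D.vectorspace_axioms K.Ker.vectorspace_axioms D.module_axioms K.Ker.module_axioms in auto)
  interpret T: linear_map class_ring "module_vec TYPE(complex) k" ?W "\<lambda>y. ?V *\<^sub>v y"
    by (rule hom)
  have "D.dim = K.Ker.dim"
  proof (rule T.dim_eq)
    show "D.fin_dim" by simp
    show "inj_on (\<lambda>y. ?V *\<^sub>v y) (carrier (module_vec TYPE(complex) k))"
      by (rule inj_on_inverseI[of _ "\<lambda>x. mat_adjoint ?V *\<^sub>v x"])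
        (simp add: isometry_left_inverse[OF V iso])
    show "(\<lambda>y. ?V *\<^sub>v y) ` carrier (module_vec TYPE(complex) k) = carrier ?W"
      using into onto by auto
  qed
  then show ?thesis using D.dim_is_n by simp
qed

section \<open>The block form\<close>

lemma diag_block_mat_pair:
  assumes "K \<in> carrier_mat p p" "B \<in> carrier_mat l l"
  shows "diag_block_mat [K, B] = four_block_mat K (0\<^sub>m p l) (0\<^sub>m l p) B"
  unfolding diag_block_mat.simps(2)[of K "[B]"] diag_block_mat_singleton Let_def
  using assms by simp

lemma kronecker_scaled_J:
  fixes m :: nat and s :: real
  defines "K \<equiv> kronecker_prod (complex_of_real s \<cdot>\<^sub>m 1\<^sub>m m) J_mat"
  shows "K \<in> carrier_mat (2 * m) (2 * m)"
    and "i < 2 * m \<Longrightarrow> j < 2 * m \<Longrightarrow>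
      K $$ (i, j) = (if even i \<and> j = Suc i then complex_of_real s else 0)"
proof -
  have J: "J_mat \<in> carrier_mat 2 2" by (intro carrier_matI) (simp_all add: J_mat_def mat_of_rows_list_def)
  show "K \<in> carrier_mat (2 * m) (2 * m)"
    using J unfolding K_def kronecker_prod_def by (auto simp: mult.commute)
  assume ij: "i < 2 * m" "j < 2 * m"
  have J_index: "J_mat $$ (i mod 2, j mod 2) = (if even i \<and> odd j then 1 else 0)"
    by (cases "even i"; cases "even j")
      (auto simp: J_mat_def mat_of_rows_list_def even_iff_mod_2_eq_zero odd_iff_mod_2_eq_one)
  have "K $$ (i, j) = (complex_of_real s \<cdot>\<^sub>m 1\<^sub>m m) $$ (i div 2, j div 2) * J_mat $$ (i mod 2, j mod 2)"
    using ij J unfolding K_def kronecker_prod_def by simp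
  also have "\<dots> = (if i div 2 = j div 2 \<and> even i \<and> odd j then complex_of_real s else 0)"
    using ij unfolding J_index by simp
  also have "(i div 2 = j div 2 \<and> even i \<and> odd j) \<longleftrightarrow> even i \<and> j = Suc i"
    by presburger
  finally show "K $$ (i, j) = (if even i \<and> j = Suc i then complex_of_real s else 0)" .
qed

text \<open>The products pair up disjoint coordinates, so the inequality \<open>2 a b \<le> a\<^sup>2 + b\<^sup>2\<close> uses every square
  once.\<close>

lemma paired_products_bound:
  "2 * cmod (\<Sum>i<2 * m. if even i then f (Suc i) * cnj (f i) else 0) \<le> (\<Sum>i<2 * m. (cmod (f i))\<^sup>2)"
proof (induction m)
  case (Suc m)
  let ?g = "\<lambda>i. if even i then f (Suc i) * cnj (f i) else 0"
  have "2 * cmod (\<Sum>i<2 * Suc m. ?g i) = 2 * cmod ((\<Sum>i<2 * m. ?g i) + f (Suc (2 * m)) * cnj (f (2 * m)))"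
    by simp
  also have "\<dots> \<le> 2 * (cmod (\<Sum>i<2 * m. ?g i) + cmod (f (Suc (2 * m))) * cmod (f (2 * m)))"
    by (intro mult_left_mono order_trans[OF norm_triangle_ineq]) (simp_all add: norm_mult)
  also have "\<dots> \<le> (\<Sum>i<2 * m. (cmod (f i))\<^sup>2) + (cmod (f (2 * m)))\<^sup>2 + (cmod (f (Suc (2 * m))))\<^sup>2"
    using Suc.IH sum_squares_bound[of "cmod (f (Suc (2 * m)))" "cmod (f (2 * m))"]
    by (simp add: algebra_simps)
  finally show ?case by simp
qed simp

lemma kronecker_scaled_J_form_bound:
  assumes a: "a \<in> carrier_vec (2 * m)" and s: "s \<ge> 0"
  defines "K \<equiv> kronecker_prod (complex_of_real s \<cdot>\<^sub>m 1\<^sub>m m) J_mat"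
  shows "cmod ((K *\<^sub>v a) \<bullet>c a) \<le> s / 2 * (euclid_norm a)\<^sup>2"
proof -
  note K = kronecker_scaled_J[where s = s and m = m, folded K_def]
  have Ka: "(K *\<^sub>v a) $ i = (if even i then s * a $ Suc i else 0)" if i: "i < 2 * m" for i
  proof -
    have "(K *\<^sub>v a) $ i = (\<Sum>j<2 * m. K $$ (i, j) * a $ j)"
      using i a K(1) by (simp add: scalar_prod_def lessThan_atLeast0)
    also have "\<dots> = (\<Sum>j<2 * m. if j = Suc i then (if even i then s * a $ j else 0) else 0)"
      using i by (intro sum.cong) (auto simp: K(2))
    also have "\<dots> = (if even i then s * a $ Suc i else 0)"
      using i by (auto simp: sum.delta elim!: evenE)
    finally show ?thesis .
  qed
  have "(K *\<^sub>v a) \<bullet>c a = (\<Sum>i<2 * m. (K *\<^sub>v a) $ i * cnj (a $ i))"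
    using a by (simp add: scalar_prod_def lessThan_atLeast0)
  also have "\<dots> = (\<Sum>i<2 * m. s * (if even i then a $ Suc i * cnj (a $ i) else 0))"
    by (intro sum.cong) (auto simp: Ka simp del: index_mult_mat_vec)
  also have "\<dots> = s * (\<Sum>i<2 * m. if even i then a $ Suc i * cnj (a $ i) else 0)"
    by (rule sum_distrib_left[symmetric])
  finally have "cmod ((K *\<^sub>v a) \<bullet>c a) = s / 2 * (2 * cmod (\<Sum>i<2 * m. if even i then a $ Suc i * cnj (a $ i) else 0))"
    using s by (simp add: norm_mult)
  also have "\<dots> \<le> s / 2 * (\<Sum>i<2 * m. (cmod (a $ i))\<^sup>2)"
    using s by (intro mult_left_mono paired_products_bound) simp
  also have "(\<Sum>i<2 * m. (cmod (a $ i))\<^sup>2) = (euclid_norm a)\<^sup>2"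
    using a unfolding euclid_norm_sq
    by (simp add: scalar_prod_def lessThan_atLeast0 cmod_power2 Re_sum flip: power2_eq_square)
  finally show ?thesis .
qed

text \<open>In the coordinates given by \<open>Q\<close> a unit vector splits into two parts \<open>a\<close> and \<open>b\<close>, and the forms of
  both diagonal blocks are bounded by \<open>s / 2\<close> times the squared norms of these parts.\<close>

lemma block_form_imp_num_radius_le:
  assumes A: "A \<in> carrier_mat n n" and n: "n > 0" and s: "s \<ge> 0" and m: "2 * m \<le> n"
    and B: "B \<in> carrier_mat (n - 2 * m) (n - 2 * m)"
    and sim: "unitarily_similar n A
      (diag_block_mat [kronecker_prod (complex_of_real s \<cdot>\<^sub>m 1\<^sub>m m) J_mat, B])"
    and rB: "2 * m < n \<Longrightarrow> num_radius B \<le> s / 2"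
  shows "num_radius A \<le> s / 2"
proof (rule num_radius_least[OF A n])
  let ?l = "n - 2 * m"
  define K where "K = kronecker_prod (complex_of_real s \<cdot>\<^sub>m 1\<^sub>m m) J_mat"
  have K: "K \<in> carrier_mat (2 * m) (2 * m)" unfolding K_def by (rule kronecker_scaled_J)
  define N where "N = diag_block_mat [K, B]"
  have N_block: "N = four_block_mat K (0\<^sub>m (2 * m) ?l) (0\<^sub>m ?l (2 * m)) B"
    unfolding N_def by (rule diag_block_mat_pair[OF K B])
  obtain Q where Q: "Q \<in> carrier_mat n n" and QQ: "Q * mat_adjoint Q = 1\<^sub>m n"
    and NQ: "N = mat_adjoint Q * A * Q"
    using sim unfolding unitarily_similar_def N_def K_def by blast
  fix z assume z: "z \<in> carrier_vec n" "euclid_norm z = 1"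
  define p where "p = mat_adjoint Q *\<^sub>v z"
  have p: "p \<in> carrier_vec n" unfolding p_def by (rule mat_adjoint_mult_vec_carrier[OF Q])
  have Qp: "Q *\<^sub>v p = z"
    unfolding p_def using assoc_mult_mat_vec[OF Q mat_adjoint_carrier[OF Q] z(1)] z(1) by (simp add: QQ)
  have "euclid_norm p = 1"
    unfolding p_def
    using isometry_norm[OF mat_adjoint_carrier[OF Q] _ z(1)] z(2) QQ by simp
  have AQp: "A *\<^sub>v (Q *\<^sub>v p) \<in> carrier_vec n" using A Q p by simp
  have "(A *\<^sub>v z) \<bullet>c z = (mat_adjoint Q *\<^sub>v (A *\<^sub>v (Q *\<^sub>v p))) \<bullet>c p"
    using cinner_adjoint'[OF Q p AQp] by (simp add: Qp)
  also have "mat_adjoint Q *\<^sub>v (A *\<^sub>v (Q *\<^sub>v p)) = N *\<^sub>v p"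
  proof -
    have QA: "mat_adjoint Q * A \<in> carrier_mat n n" by (rule mult_carrier_mat[OF mat_adjoint_carrier[OF Q] A])
    have Qpc: "Q *\<^sub>v p \<in> carrier_vec n" using Q p by simp
    show ?thesis unfolding NQ assoc_mult_mat_vec[OF QA Q p]
        assoc_mult_mat_vec[OF mat_adjoint_carrier[OF Q] A Qpc] ..
  qed
  finally have form: "(A *\<^sub>v z) \<bullet>c z = (N *\<^sub>v p) \<bullet>c p" .
  define a where "a = vec_first p (2 * m)"
  define b where "b = vec_last p ?l"
  have a: "a \<in> carrier_vec (2 * m)" and b: "b \<in> carrier_vec ?l" by (simp_all add: a_def b_def)
  have pab: "p = a @\<^sub>v b" unfolding a_def b_def using p m by simp
  have Ka: "K *\<^sub>v a \<in> carrier_vec (2 * m)" and Bb: "B *\<^sub>v b \<in> carrier_vec ?l"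
    using K B a b by auto
  have "N *\<^sub>v p = (K *\<^sub>v a) @\<^sub>v (B *\<^sub>v b)"
    unfolding N_block pab using K B a b by (intro mult_mat_vec_split)
  moreover have conj: "conjugate (a @\<^sub>v b) = conjugate a @\<^sub>v conjugate b"
    by (intro eq_vecI) auto
  ultimately have split: "(N *\<^sub>v p) \<bullet>c p = (K *\<^sub>v a) \<bullet>c a + (B *\<^sub>v b) \<bullet>c b"
    unfolding pab using a b Ka Bb by (simp add: scalar_prod_append[of _ "2 * m" _ ?l])
  have "p \<bullet>c p = a \<bullet>c a + b \<bullet>c b"
    unfolding pab conj using a b by (simp add: scalar_prod_append[of _ "2 * m" _ ?l])
  then have "complex_of_real ((euclid_norm p)\<^sup>2) = complex_of_real ((euclid_norm a)\<^sup>2 + (euclid_norm b)\<^sup>2)"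
    unfolding cinner_self by simp
  then have norms: "(euclid_norm a)\<^sup>2 + (euclid_norm b)\<^sup>2 = 1"
    unfolding of_real_eq_iff \<open>euclid_norm p = 1\<close> by simp
  have "cmod ((B *\<^sub>v b) \<bullet>c b) \<le> s / 2 * (euclid_norm b)\<^sup>2"
  proof (cases "2 * m < n")
    case True
    then have "cmod ((B *\<^sub>v b) \<bullet>c b) \<le> num_radius B * (euclid_norm b)\<^sup>2"
      using num_radius_bound[OF B _ b] by simp
    also have "\<dots> \<le> s / 2 * (euclid_norm b)\<^sup>2" using rB[OF True] by (intro mult_right_mono) auto
    finally show ?thesis .
  next
    case False
    then have "(B *\<^sub>v b) \<bullet>c b = 0" using b by (simp add: scalar_prod_def)
    then show ?thesis using s by simp
  qed
  moreover have "cmod ((K *\<^sub>v a) \<bullet>c a) \<le> s / 2 * (euclid_norm a)\<^sup>2"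
    unfolding K_def by (rule kronecker_scaled_J_form_bound[OF a s])
  moreover have "cmod ((A *\<^sub>v z) \<bullet>c z) \<le> cmod ((K *\<^sub>v a) \<bullet>c a) + cmod ((B *\<^sub>v b) \<bullet>c b)"
    unfolding form split by (rule norm_triangle_ineq)
  ultimately have "cmod ((A *\<^sub>v z) \<bullet>c z) \<le> s / 2 * ((euclid_norm a)\<^sup>2 + (euclid_norm b)\<^sup>2)"
    by (simp add: distrib_left)
  then show "cmod ((A *\<^sub>v z) \<bullet>c z) \<le> s / 2" unfolding norms by simp
qed

text \<open>Let \<open>v 0, \<dots>, v (m - 1)\<close> be an orthonormal basis of \<^const>\<open>V_max\<close>, with normalized images \<open>u i\<close>.
  As \<open>A\<^sup>* A\<close> is \<open>s\<^sup>2\<close> on \<^const>\<open>V_max\<close>, the \<open>u i\<close> are orthonormal, and \<open>A\<^sup>* v i = 0\<close> makes every \<open>u i\<close>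
  orthogonal to every \<open>v j\<close>. Complete the family \<open>u 0, v 0, u 1, v 1, \<dots>\<close> to an orthonormal basis
  of the whole space. Each pair \<open>u i, v i\<close> contributes a block \<open>s J\<close>, because \<open>A u i = 0\<close> and
  \<open>A v i = s u i\<close>. The remaining columns do not interact with these blocks, because \<open>A\<^sup>*\<close> maps
  \<open>u i\<close> to \<open>s v i\<close> and annihilates \<open>v i\<close>. The remaining block \<open>B\<close> is a compression of \<open>A\<close> to the
  complement, which bounds its numerical radius; its norm is attained at a vector orthogonal to
  \<^const>\<open>V_max\<close>, and is therefore strictly smaller than \<open>s\<close>.\<close>

lemma extremal_imp_block_form:
  assumes A: "A \<in> carrier_mat n n" and nz: "A \<noteq> 0\<^sub>m n n"
    and eq: "op_norm A = 2 * num_radius A"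
  shows "2 * V_max_dim A \<le> n \<and>
        (\<exists>B \<in> carrier_mat (n - 2 * V_max_dim A) (n - 2 * V_max_dim A).
           unitarily_similar n A
             (diag_block_mat
                [kronecker_prod (complex_of_real (op_norm A) \<cdot>\<^sub>m 1\<^sub>m (V_max_dim A)) J_mat, B]) \<and>
           (2 * V_max_dim A < n \<longrightarrow>
              op_norm B < op_norm A \<and> num_radius B \<le> 1 / 2 * op_norm A))"
proof -
  let ?s = "op_norm A"
  note n = op_norm_pos(1)[OF A nz] and s = op_norm_pos(2)[OF A nz]
  define M where "M = complex_of_real (?s\<^sup>2) \<cdot>\<^sub>m 1\<^sub>m n - mat_adjoint A * A"
  have M: "M \<in> carrier_mat n n" unfolding M_def
    by (intro minus_carrier_mat mult_carrier_mat[OF mat_adjoint_carrier[OF A] A])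
  have V_ker: "V_max A = mat_kernel M"
    unfolding M_def by (rule V_max_iff_eigenvector(2)[OF A n])
  obtain m v where v: "orthonormal n m v" and vker: "\<And>i. i < m \<Longrightarrow> v i \<in> mat_kernel M"
    and vmax: "\<And>x. x \<in> mat_kernel M \<Longrightarrow> (\<And>i. i < m \<Longrightarrow> x \<bullet>c v i = 0) \<Longrightarrow> x = 0\<^sub>v n"
    using maximal_orthonormal_in_kernel[OF M] by blast
  have dim: "V_max_dim A = m"
    unfolding V_max_dim_def V_ker carrier_matD(2)[OF A]
    using vker vmax by (rule kernel_dim_eq_orthonormal_card[OF M v])
  define u where "u i = normalized_image A (v i)" for i
  have loc: "max_singular_vector A n (v i)" if "i < m" for i
    using that v vker A nz unfolding V_ker[symmetric]
    by unfold_locales (auto simp: orthonormal_def euclid_norm_def)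
  note A_v = max_singular_vector.A_v[OF loc, folded u_def]
    and adjoint_u = max_singular_vector.adjoint_u[OF loc, folded u_def]
    and u_carrier = max_singular_vector.u_carrier[OF loc, folded u_def]
    and ann = max_singular_vector.extremal_imp_annihilated[OF loc eq, folded u_def]
  have v_carrier: "v i \<in> carrier_vec n" if "i < m" for i using v that by (simp add: orthonormal_def)
  have vv: "v i \<bullet>c v j = (if i = j then 1 else 0)" if "i < m" "j < m" for i j
    using v that by (simp add: orthonormal_def)
  have uu: "u i \<bullet>c u j = (if i = j then 1 else 0)" if ij: "i < m" "j < m" for i j
  proof -
    have "?s * (u i \<bullet>c u j) = (A *\<^sub>v v i) \<bullet>c u j"
      unfolding A_v[OF ij(1)] using u_carrier ij by (simp add: cinner_simps[of _ n])
    also have "\<dots> = v i \<bullet>c (complex_of_real ?s \<cdot>\<^sub>v v j)"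
      unfolding cinner_adjoint[OF A v_carrier[OF ij(1)] u_carrier[OF ij(2)]] adjoint_u[OF ij(2)] ..
    also have "\<dots> = ?s * (v i \<bullet>c v j)" using v_carrier ij by (simp add: cinner_simps[of _ n])
    finally show ?thesis using s vv[OF ij] by simp
  qed
  have uv: "u i \<bullet>c v j = 0" if ij: "i < m" "j < m" for i j
  proof -
    have "?s * (u i \<bullet>c v j) = (A *\<^sub>v v i) \<bullet>c v j"
      unfolding A_v[OF ij(1)] using u_carrier v_carrier ij by (simp add: cinner_simps[of _ n])
    also have "\<dots> = 0"
      unfolding cinner_adjoint[OF A v_carrier[OF ij(1)] v_carrier[OF ij(2)]] ann(2)[OF ij(2)]
      using v_carrier ij by simp
    finally show ?thesis using s by simp
  qed
  have vu: "v i \<bullet>c u j = 0" if "i < m" "j < m" for i j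
    using uv[OF that(2,1)] cinner_commute[of "u j" n "v i"] u_carrier v_carrier that by simp
  define f where "f i = (if even i then u (i div 2) else v (i div 2))" for i :: nat
  have f: "orthonormal n (2 * m) f"
    unfolding orthonormal_def
  proof (intro conjI allI impI)
    fix i assume "i < 2 * m"
    then show "f i \<in> carrier_vec n" using u_carrier v_carrier by (auto simp: f_def)
    fix j assume "j < 2 * m"
    have "i = j" if "even i = even j" "i div 2 = j div 2"
      using that by (metis dvd_mult_div_cancel odd_two_times_div_two_succ)
    then show "f i \<bullet>c f j = (if i = j then 1 else 0)"
      using \<open>i < 2 * m\<close> \<open>j < 2 * m\<close> uu uv vu vv by (auto simp: f_def)
  qed
  have m: "2 * m \<le> n" by (rule orthonormal_le_dim[OF f])
  let ?l = "n - 2 * m"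
  obtain w where w: "orthonormal n ?l w"
    and wf: "\<And>i j. i < 2 * m \<Longrightarrow> j < ?l \<Longrightarrow> w j \<bullet>c f i = 0"
    using orthonormal_completion[OF f] by blast
  define q where "q i = (if i < 2 * m then f i else w (i - 2 * m))" for i
  have q: "orthonormal n n q"
    using orthonormal_append[OF f w wf] m unfolding q_def by simp
  have q_carrier: "q i \<in> carrier_vec n" if "i < n" for i using q that by (simp add: orthonormal_def)
  have qq: "q i \<bullet>c q j = (if i = j then 1 else 0)" if "i < n" "j < n" for i j
    using q that by (simp add: orthonormal_def)
  define Q where "Q = cols_mat n n q"
  have Q: "Q \<in> carrier_mat n n" by (simp add: Q_def)
  have Q1: "mat_adjoint Q * Q = 1\<^sub>m n" unfolding Q_def by (rule orthonormal_isometry[OF q])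
  have Q2: "Q * mat_adjoint Q = 1\<^sub>m n"
    by (rule mat_mult_left_right_inverse[OF mat_adjoint_carrier[OF Q] Q Q1])
  define W where "W = cols_mat n ?l w"
  have W: "W \<in> carrier_mat n ?l" by (simp add: W_def)
  have W1: "mat_adjoint W * W = 1\<^sub>m ?l" unfolding W_def by (rule orthonormal_isometry[OF w])
  define B where "B = mat_adjoint W * A * W"
  have WA: "mat_adjoint W * A \<in> carrier_mat ?l n" by (rule mult_carrier_mat[OF mat_adjoint_carrier[OF W] A])
  have B: "B \<in> carrier_mat ?l ?l" unfolding B_def by (rule mult_carrier_mat[OF WA W])
  have B_index: "B $$ (i, j) = (A *\<^sub>v w j) \<bullet>c w i" if "i < ?l" "j < ?l" for i j
    unfolding B_def adjoint_conjugation_index[OF W A that]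
    using that w by (simp add: W_def col_cols_mat orthonormal_def)
  define K where "K = kronecker_prod (complex_of_real ?s \<cdot>\<^sub>m 1\<^sub>m m) J_mat"
  note K = kronecker_scaled_J[where s = ?s and m = m, folded K_def]
  have block: "diag_block_mat [K, B] = mat_adjoint Q * A * Q"
  proof (rule eq_matI)
    show "dim_row (diag_block_mat [K, B]) = dim_row (mat_adjoint Q * A * Q)"
      "dim_col (diag_block_mat [K, B]) = dim_col (mat_adjoint Q * A * Q)"
      unfolding diag_block_mat_pair[OF K(1) B] using K(1) B Q m by auto
    fix i j assume "i < dim_row (mat_adjoint Q * A * Q)" "j < dim_col (mat_adjoint Q * A * Q)"
    then have ij: "i < n" "j < n" using Q by auto
    have lhs: "diag_block_mat [K, B] $$ (i, j) =
      (if i < 2 * m then if j < 2 * m then K $$ (i, j) else 0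
       else if j < 2 * m then 0 else B $$ (i - 2 * m, j - 2 * m))"
      unfolding diag_block_mat_pair[OF K(1) B] using ij m K(1) B by auto
    have rhs: "(mat_adjoint Q * A * Q) $$ (i, j) = (A *\<^sub>v q j) \<bullet>c q i"
      unfolding adjoint_conjugation_index[OF Q A ij]
      using ij q_carrier by (simp add: Q_def col_cols_mat)
    \<comment> \<open>Columns \<open>2 a\<close> and \<open>2 a + 1\<close> are \<open>u a\<close> and \<open>v a\<close>; the upper right block is computed via \<open>A\<^sup>*\<close>.\<close>
    consider "j < 2 * m" "even j" | "j < 2 * m" "odd j" | "j \<ge> 2 * m" "i < 2 * m" "even i"
      | "j \<ge> 2 * m" "i < 2 * m" "odd i" | "j \<ge> 2 * m" "i \<ge> 2 * m" by linarith
    then have "(A *\<^sub>v q j) \<bullet>c q i =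
      (if i < 2 * m then if j < 2 * m then K $$ (i, j) else 0
       else if j < 2 * m then 0 else B $$ (i - 2 * m, j - 2 * m))"
    proof cases
      case 1
      then have "A *\<^sub>v q j = 0\<^sub>v n" using ann(1) by (simp add: q_def f_def)
      then have "(A *\<^sub>v q j) \<bullet>c q i = 0" using q_carrier ij by simp
      then show ?thesis using 1 K(2)[of i j] by auto
    next
      case 2
      then obtain a where a: "j = Suc (2 * a)" by (auto elim!: oddE)
      have "A *\<^sub>v q j = complex_of_real ?s \<cdot>\<^sub>v q (2 * a)"
        using 2 A_v[of a] by (simp add: a q_def f_def)
      then have "(A *\<^sub>v q j) \<bullet>c q i = ?s * (q (2 * a) \<bullet>c q i)"
        using q_carrier ij a by (simp add: cinner_simps[of _ n])
      also have "\<dots> = (if i = 2 * a then ?s else 0)" using qq[of "2 * a" i] ij a by simp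
      finally show ?thesis using 2 K(2)[of i j] a by auto
    next
      case 3
      then obtain a where a: "i = 2 * a" by (auto elim!: evenE)
      have "(A *\<^sub>v q j) \<bullet>c q i = q j \<bullet>c (mat_adjoint A *\<^sub>v q i)"
        by (rule cinner_adjoint[OF A q_carrier[OF ij(2)] q_carrier[OF ij(1)]])
      also have "mat_adjoint A *\<^sub>v q i = complex_of_real ?s \<cdot>\<^sub>v q (Suc i)"
        using 3 adjoint_u[of a] by (simp add: a q_def f_def)
      also have "q j \<bullet>c (complex_of_real ?s \<cdot>\<^sub>v q (Suc i)) = ?s * (q j \<bullet>c q (Suc i))"
        using q_carrier[of j] q_carrier[of "Suc i"] 3 m ij a by (simp add: cinner_simps[of _ n])
      also have "\<dots> = 0" using qq[of j "Suc i"] 3 m ij a by auto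
      finally show ?thesis using 3 by simp
    next
      case 4
      have "(A *\<^sub>v q j) \<bullet>c q i = q j \<bullet>c (mat_adjoint A *\<^sub>v q i)"
        by (rule cinner_adjoint[OF A q_carrier[OF ij(2)] q_carrier[OF ij(1)]])
      also have "mat_adjoint A *\<^sub>v q i = 0\<^sub>v n"
        using 4 ann(2)[of "i div 2"] by (simp add: q_def f_def)
      finally show ?thesis using 4 q_carrier ij by simp
    next
      case 5
      then show ?thesis using B_index[of "i - 2 * m" "j - 2 * m"] ij by (simp add: q_def)
    qed
    then show "diag_block_mat [K, B] $$ (i, j) = (mat_adjoint Q * A * Q) $$ (i, j)"
      unfolding lhs rhs ..
  qed
  have sim: "unitarily_similar n A (diag_block_mat [K, B])"
  proof -
    have "mat_adjoint Q * A * Q \<in> carrier_mat n n"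
      by (rule mult_carrier_mat[OF mult_carrier_mat[OF mat_adjoint_carrier[OF Q] A] Q])
    then show ?thesis unfolding unitarily_similar_def block using A Q Q1 Q2 by blast
  qed
  have small: "op_norm B < ?s \<and> num_radius B \<le> 1 / 2 * ?s" if "2 * m < n"
  proof
    have l: "?l > 0" using that by simp
    have By: "B *\<^sub>v y = mat_adjoint W *\<^sub>v (A *\<^sub>v (W *\<^sub>v y))"
      and Wy: "W *\<^sub>v y \<in> carrier_vec n" "euclid_norm (W *\<^sub>v y) = euclid_norm y"
      if y: "y \<in> carrier_vec ?l" for y
    proof -
      show Wy: "W *\<^sub>v y \<in> carrier_vec n" by (rule mult_mat_vec_carrier[OF W y])
      show "B *\<^sub>v y = mat_adjoint W *\<^sub>v (A *\<^sub>v (W *\<^sub>v y))"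
        unfolding B_def assoc_mult_mat_vec[OF WA W y]
          assoc_mult_mat_vec[OF mat_adjoint_carrier[OF W] A Wy] ..
      show "euclid_norm (W *\<^sub>v y) = euclid_norm y" by (rule isometry_norm[OF W W1 y])
    qed
    obtain y where y: "y \<in> carrier_vec ?l" "euclid_norm y = 1" "euclid_norm (B *\<^sub>v y) = op_norm B"
      using op_norm_attained[OF B l] by blast
    let ?x = "W *\<^sub>v y"
    have Ax: "A *\<^sub>v ?x \<in> carrier_vec n" by (rule mult_mat_vec_carrier[OF A Wy(1)[OF y(1)]])
    have x_orth: "?x \<bullet>c v i = 0" if i: "i < m" for i
    proof -
      have "mat_adjoint W *\<^sub>v v i = 0\<^sub>v ?l"
      proof (rule eq_vecI)
        fix j assume "j < dim_vec (0\<^sub>v ?l :: complex vec)"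
        then have j: "j < ?l" by simp
        have "(mat_adjoint W *\<^sub>v v i) $ j = v i \<bullet>c w j"
          unfolding adjoint_mult_vec_index[OF W v_carrier[OF i] j]
          using j w by (simp add: W_def col_cols_mat orthonormal_def)
        also have "\<dots> = cnj (w j \<bullet>c v i)"
          using cinner_commute[of "w j" n "v i"] w j v_carrier[OF i] by (simp add: orthonormal_def)
        also have "w j \<bullet>c v i = 0" using wf[of "Suc (2 * i)" j] i j by (simp add: f_def)
        finally show "(mat_adjoint W *\<^sub>v v i) $ j = 0\<^sub>v ?l $ j" using j by simp
      qed (use W in simp)
      then show ?thesis
        unfolding cinner_adjoint[OF W y(1) v_carrier[OF i]] using y(1) by simp
    qed
    have "?x \<notin> V_max A"
    proof
      assume "?x \<in> V_max A"
      then have "?x = 0\<^sub>v n" unfolding V_ker using x_orth by (rule vmax)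
      then show False using Wy(2)[OF y(1)] y(2) by simp
    qed
    then have "euclid_norm (A *\<^sub>v ?x) \<noteq> ?s * 1"
      using Wy[OF y(1)] y(2) A by (auto simp: V_max_def)
    then have "euclid_norm (A *\<^sub>v ?x) < ?s"
      using op_norm_bound[OF A n Wy(1)[OF y(1)]] Wy(2)[OF y(1)] y(2) by simp
    moreover have "op_norm B \<le> euclid_norm (A *\<^sub>v ?x)"
      unfolding y(3)[symmetric] By[OF y(1)] by (rule isometry_adjoint_contraction[OF W W1 Ax])
    ultimately show "op_norm B < ?s" by simp
    show "num_radius B \<le> 1 / 2 * ?s"
    proof (rule num_radius_least[OF B l])
      fix y assume y: "y \<in> carrier_vec ?l" "euclid_norm y = 1"
      have AWy: "A *\<^sub>v (W *\<^sub>v y) \<in> carrier_vec n" by (rule mult_mat_vec_carrier[OF A Wy(1)[OF y(1)]])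
      have "(B *\<^sub>v y) \<bullet>c y = (A *\<^sub>v (W *\<^sub>v y)) \<bullet>c (W *\<^sub>v y)"
        unfolding By[OF y(1)] by (rule cinner_adjoint'[OF W y(1) AWy, symmetric])
      then show "cmod ((B *\<^sub>v y) \<bullet>c y) \<le> 1 / 2 * ?s"
        using num_radius_upper[OF A n Wy(1)[OF y(1)]] Wy(2)[OF y(1)] y(2) eq by simp
    qed
  qed
  show ?thesis unfolding dim using m B sim small unfolding K_def by blast
qed

section \<open>The equivalence\<close>

theorem theorem9:
  fixes A :: "complex mat" and n :: nat
  assumes "A \<in> carrier_mat n n" and "A \<noteq> 0\<^sub>m n n"
  shows
    "(op_norm A = 2 * num_radius A \<longleftrightarrow> Theta A \<noteq> {}) \<and>
     (op_norm A = 2 * num_radius A \<longleftrightarrow> Theta A = Omega A) \<and>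
     (op_norm A = 2 * num_radius A \<longleftrightarrow>
        (\<forall>v \<in> V_max A. euclid_norm v = 1 \<longrightarrow>
           v \<in> mat_range (mat_adjoint A) \<inter> mat_kernel (mat_adjoint A) \<and>
           A *\<^sub>v v \<in> mat_range A \<inter> mat_kernel A \<and>
           maximizes_num_radius A
             (complex_of_real (1 / sqrt 2) \<cdot>\<^sub>v (v + normalized_image A v)))) \<and>
     (op_norm A = 2 * num_radius A \<longleftrightarrow>
        (\<exists>v \<in> V_max A. euclid_norm v = 1 \<and>
           v \<in> mat_range (mat_adjoint A) \<inter> mat_kernel (mat_adjoint A) \<and>
           A *\<^sub>v v \<in> mat_range A \<inter> mat_kernel A \<and>
           maximizes_num_radius A
             (complex_of_real (1 / sqrt 2) \<cdot>\<^sub>v (v + normalized_image A v)))) \<and>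
     (op_norm A = 2 * num_radius A \<longleftrightarrow>
        2 * V_max_dim A \<le> n \<and>
        (\<exists>B \<in> carrier_mat (n - 2 * V_max_dim A) (n - 2 * V_max_dim A).
           unitarily_similar n A
             (diag_block_mat
                [kronecker_prod (complex_of_real (op_norm A) \<cdot>\<^sub>m 1\<^sub>m (V_max_dim A)) J_mat, B]) \<and>
           (2 * V_max_dim A < n \<longrightarrow>
              op_norm B < op_norm A \<and> num_radius B \<le> 1 / 2 * op_norm A))) \<and>
     (op_norm A = 2 * num_radius A \<longleftrightarrow>
        field_of_values A = cball 0 (1 / 2 * op_norm A))"
    (is "(?E \<longleftrightarrow> ?C2) \<and> (?E \<longleftrightarrow> ?C3) \<and> (?E \<longleftrightarrow> (\<forall>v \<in> V_max A. euclid_norm v = 1 \<longrightarrow> ?P v)) \<and>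
      (?E \<longleftrightarrow> (\<exists>v \<in> V_max A. euclid_norm v = 1 \<and> ?P v)) \<and> (?E \<longleftrightarrow> ?C6) \<and> (?E \<longleftrightarrow> ?C7)")
proof -
  note A = assms(1) and n = op_norm_pos(1)[OF assms] and s = op_norm_pos(2)[OF assms]
  have loc: "max_singular_vector A n v" if "v \<in> V_max A" "euclid_norm v = 1" for v
    using that assms by unfold_locales
  have ann: "max_singular_vector.annihilated A n v" if "?E" "max_singular_vector A n v" for v
    using max_singular_vector.extremal_imp_annihilated[OF that(2,1)]
    unfolding max_singular_vector.annihilated_def[OF that(2)] by blast
  obtain v0 where v0: "max_singular_vector A n v0"
    using max_singular_vector_exists[OF assms] .
  have extremalI: ?E if "num_radius A \<le> 1 / 2 * op_norm A"
    using max_singular_vector.op_norm_le_twice_num_radius[OF v0] that by simp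
  have Omega_subset: "Omega A \<subseteq> Theta A" if E: ?E
  proof
    fix z assume "z \<in> Omega A"
    then obtain v \<alpha> \<beta> where v: "v \<in> V_max A" "euclid_norm v = 1"
      and z: "z = complex_of_real (1 / sqrt 2) \<cdot>\<^sub>v
       (exp (\<i> * complex_of_real \<alpha>) \<cdot>\<^sub>v v + exp (\<i> * complex_of_real \<beta>) \<cdot>\<^sub>v normalized_image A v)"
      unfolding Omega_def by blast
    show "z \<in> Theta A" unfolding z
      by (rule max_singular_vector.extremal_imp_in_Theta[OF loc[OF v] E ann[OF E loc[OF v]]])
        (simp_all flip: cis_conv_exp)
  qed
  have Omega_nonempty: "Omega A \<noteq> {}"
    using max_singular_vector.v_max[OF v0] max_singular_vector.v_unit[OF v0]
    unfolding Omega_def by blast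
  have c2: "?E \<longleftrightarrow> ?C2"
    using Omega_subset Omega_nonempty Theta_imp_extremal(1)[OF assms] by blast
  have c3: "?E \<longleftrightarrow> ?C3"
  proof
    assume E: ?E
    show ?C3 using Omega_subset[OF E] Theta_imp_extremal(2)[OF assms] by blast
  next
    assume ?C3
    then show ?E using Omega_nonempty c2 by simp
  qed
  have P: "?P v" if E: ?E and v: "v \<in> V_max A" "euclid_norm v = 1" for v
    using max_singular_vector.annihilated_memberships[OF loc[OF v] ann[OF E loc[OF v]]]
      max_singular_vector.extremal_imp_maximizer[OF loc[OF v] E ann[OF E loc[OF v]]] by blast
  have P_imp: ?E if v: "v \<in> V_max A" "euclid_norm v = 1" and "?P v" for v
  proof -
    have "max_singular_vector.annihilated A n v"
      using \<open>?P v\<close> by (intro max_singular_vector.annihilated_if_memberships[OF loc[OF v]]) auto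
    then show ?E
      using \<open>?P v\<close> by (intro max_singular_vector.maximizer_imp_extremal[OF loc[OF v]]) auto
  qed
  have v0': "v0 \<in> V_max A" "euclid_norm v0 = 1"
    using max_singular_vector.v_max[OF v0] max_singular_vector.v_unit[OF v0] .
  have c4: "?E \<longleftrightarrow> (\<forall>v \<in> V_max A. euclid_norm v = 1 \<longrightarrow> ?P v)"
    using P P_imp[OF v0'] v0' by blast
  have c5: "?E \<longleftrightarrow> (\<exists>v \<in> V_max A. euclid_norm v = 1 \<and> ?P v)"
    using P[OF _ v0'] P_imp v0' by blast
  have c6: "?E \<longleftrightarrow> ?C6"
  proof
    assume ?E
    then show ?C6 by (rule extremal_imp_block_form[OF assms])
  next
    assume ?C6
    then obtain B where "2 * V_max_dim A \<le> n"
      and "B \<in> carrier_mat (n - 2 * V_max_dim A) (n - 2 * V_max_dim A)"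
      and "unitarily_similar n A (diag_block_mat
          [kronecker_prod (complex_of_real (op_norm A) \<cdot>\<^sub>m 1\<^sub>m (V_max_dim A)) J_mat, B])"
      and "2 * V_max_dim A < n \<longrightarrow> op_norm B < op_norm A \<and> num_radius B \<le> 1 / 2 * op_norm A"
      by blast
    then have "num_radius A \<le> op_norm A / 2"
      using s by (intro block_form_imp_num_radius_le[OF A n]) auto
    then show ?E by (intro extremalI) simp
  qed
  have c7: "?E \<longleftrightarrow> ?C7"
  proof
    assume E: ?E
    show ?C7 by (rule max_singular_vector.extremal_imp_disk[OF v0 E ann[OF E v0]])
  next
    assume disk: ?C7
    have "num_radius A \<le> 1 / 2 * op_norm A"
    proof (rule num_radius_least[OF A n])
      fix z assume "z \<in> carrier_vec n" "euclid_norm z = 1"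
      then have "(A *\<^sub>v z) \<bullet>c z \<in> field_of_values A" using A by (auto simp: field_of_values_def)
      then show "cmod ((A *\<^sub>v z) \<bullet>c z) \<le> 1 / 2 * op_norm A" unfolding disk by simp
    qed
    then show ?E by (rule extremalI)
  qed
  show ?thesis using c2 c3 c4 c5 c6 c7 by (intro conjI)
qed

end
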